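(* Let $m\in\mathbb{N}$. For all $n\in\mathbb{Z}$, $\lambda\in\mathcal{Z}_{m,n}$, $k\in\{0,1,\dots,m\}$ and all $\xi\in A^{(0,0)}(\mathbb{P}^1,\mathcal{O}(m))$: $$(1\otimes z^k,\Delta_{\overline{\mathcal{O}(m)}_\infty}\xi)_{L^2,\infty}=0,$$ $$(\varphi^{(m)}_{n,\lambda},\Delta_{\overline{\mathcal{O}(m)}_\infty}\xi)_{L^2,\infty}=\frac{\lambda^2}{4}(\varphi^{(m)}_{n,\lambda},\xi)_{L^2,\infty},$$ $$(\varphi^{(m)}_{-n+m,\lambda},\Delta_{\overline{\mathcal{O}(m)}_\infty}\xi)_{L^2,\infty}=\frac{\lambda^2}{4}(\varphi^{(m)}_{-n+m,\lambda},\xi)_{L^2,\infty}.$$ In particular $\{0\}\cup\{\frac{\lambda^2}{4}\mid \exists n\in\mathbb{N},\ \lambda\in\mathcal{Z}_{m,n}\}\subset\mathrm{Spec}(\Delta_{\overline{\mathcal{O}(m)}_\infty})$.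
   Context: $\mathbb{N}=\{0,1,2,\dots\}$. $\mathbb{P}^1$ is the complex projective line with homogeneous coordinates $[x_0:x_1]$ and affine coordinate $z=x_1/x_0=re^{i\theta}$; $\mathbb{S}^1=\{|z|=1\}$. $A^{(0,0)}(\mathbb{P}^1)$ is the space of $C^\infty$ complex functions on $\mathbb{P}^1$ and $A^{(0,0)}(\mathbb{P}^1,\mathcal{O}(m))$ the space of $C^\infty$ global sections of $\mathcal{O}(m)$. The holomorphic global sections of $\mathcal{O}(m)$ have basis $1,z,\dots,z^m$ ($z^k$ corresponds to $x_0^{m-k}x_1^k$); $f\otimes z^k$ denotes the section $f\cdot z^k$. Every element of $A^{(0,0)}(\mathbb{P}^1,\mathcal{O}(m))$ is of the form $\sum_{k=0}^m f_k\otimes z^k$ with $f_k\in A^{(0,0)}(\mathbb{P}^1)$. Canonical metric on $\mathcal{O}(m)$: $h_m(z^k,z^l)(z)=z^k\bar z^l/\max(1,|z|)^{2m}$. Canonical Kähler form: $\omega_\infty=\frac{i}{2\pi}\frac{dz\wedge d\bar z}{\max(1,|z|)^4}$, with corresponding metric $h_T(\partial_z,\partial_z)=\max(1,|z|)^{-4}$ on $T\mathbb{P}^1$. Hermitian product: $(\xi,\xi')_{L^2,\infty}=\int_{\mathbb{P}^1}h_m(\xi,\xi')\,\omega_\infty$; $\mathcal{H}^{(m)}$ is the Hilbert completion of $A^{(0,0)}(\mathbb{P}^1,\mathcal{O}(m))$ for it. $\Delta_{\overline{\mathcal{O}(m)}_\infty}:A^{(0,0)}(\mathbb{P}^1,\mathcal{O}(m))\to\mathcal{H}^{(m)}$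 is defined on $\mathbb{P}^1\setminus\mathbb{S}^1$ by $$\Delta_{\overline{\mathcal{O}(m)}_\infty}(f\otimes z^k)=-h_T(\partial_z,\partial_z)^{-1}h_m(z^k,z^k)^{-1}\frac{\partial}{\partial z}\Bigl(h_m(z^k,z^k)\frac{\partial f}{\partial\bar z}\Bigr)\otimes z^k,$$ extended by linearity. $\mathrm{Spec}(\Delta_{\overline{\mathcal{O}(m)}_\infty})$ is the set of $\alpha$ for which there is a nonzero $\varphi\in\mathcal{H}^{(m)}$ with $(\varphi,\Delta_{\overline{\mathcal{O}(m)}_\infty}\xi)_{L^2,\infty}=\alpha(\varphi,\xi)_{L^2,\infty}$ for all $\xi\in A^{(0,0)}(\mathbb{P}^1,\mathcal{O}(m))$. $J_n$ is the Bessel function of the first kind of integer order $n$. For $n\in\mathbb{Z}$, $L_{m,n}(z)=-z^m\frac{d}{dz}\bigl(z^{-m}J_n(z)J_{n-m}(z)\bigr)$ (entire after extension) and $\mathcal{Z}_{m,n}=\{\lambda\in\mathbb{C}^*: L_{m,n}(\lambda)=0\}$; one has $\mathcal{Z}_{m,m-n}=\mathcal{Z}_{m,n}$. For $\lambda\in\mathcal{Z}_{m,n}$ put $\varphi^{(m)}_{n,\lambda}=f^{(m)}_{n,\lambda}\otimes 1$, where: - if $m\ge1$ (it being taken that $J_n(\lambda)J_{n-m}(\lambda)\ne0$ for $\lambda\in\mathcal{Z}_{m,n}$): $f^{(m)}_{n,\lambda}(re^{i\theta})=J_n(\lambda r)e^{in\theta}$ for $r<1$ and $\frac{J_n(\lambda)}{J_{n-m}(\lambda)}r^mJ_{n-m}(\lambda/r)e^{in\theta}$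 for $r>1$; - if $m=0$ and $J_n'(\lambda)=0$: $f^{(0)}_{n,\lambda}(re^{i\theta})=J_n(\lambda r)e^{in\theta}$ for $r<1$ and $J_n(\lambda/r)e^{in\theta}$ for $r>1$; - if $m=0$ and $J_n(\lambda)=0$: $f^{(0)}_{n,\lambda}(re^{i\theta})=-J_n(\lambda r)e^{in\theta}$ for $r<1$ and $J_n(\lambda/r)e^{in\theta}$ for $r>1$. *)

theory Defs
  imports "HOL-Analysis.Analysis"
begin

section \<open>Smooth functions and sections on the projective line\<close>

text \<open>
  \<open>cont_diff k f\<close>: f is of class \<open>C^k\<close> on the real plane underlying the complex numbers
  (\<^const>\<open>frechet_derivative\<close> is the real-linear derivative).
\<close>

primrec cont_diff :: "nat \<Rightarrow> (complex \<Rightarrow> complex) \<Rightarrow> bool" where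
  "cont_diff 0 f = continuous_on UNIV f"
| "cont_diff (Suc k) f =
     ((\<forall>z. f differentiable (at z)) \<and> (\<forall>v. cont_diff k (\<lambda>z. frechet_derivative f (at z) v)))"

definition smooth :: "(complex \<Rightarrow> complex) \<Rightarrow> bool" where
  "smooth f \<longleftrightarrow> (\<forall>k. cont_diff k f)"

text \<open>
  Everywhere below a section of \<open>O(m)\<close> on the projective line is recorded by its coefficient s
  with respect to the frame 1 (that is, \<open>x_0^m\<close>) on the affine chart with coordinate
  \<open>z = x_1/x_0\<close>. Near infinity the coordinate is \<open>w = 1/z\<close>, the frame is \<open>x_1^m = z^m x_0^m\<close>,
  and so the coefficient of the same section is \<open>w^m s(1/w)\<close>. A continuous section is determined
  by its restriction to the affine chart, and the point at infinity is a null set for the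
  integrals. For \<open>m = 0\<close> these are the smooth functions on the projective line.
\<close>

definition smooth_sections :: "nat \<Rightarrow> (complex \<Rightarrow> complex) set" where
  "smooth_sections m =
     {s. smooth s \<and> (\<exists>t. smooth t \<and> (\<forall>w. w \<noteq> 0 \<longrightarrow> t w = w ^ m * s (1 / w)))}"

definition tensor_z :: "(complex \<Rightarrow> complex) \<Rightarrow> nat \<Rightarrow> complex \<Rightarrow> complex" (infixl "\<otimes>z" 75) where
  "f \<otimes>z k = (\<lambda>z. f z * z ^ k)"


section \<open>Canonical metrics and the Hilbert completion\<close>

text \<open>The value at the point z of the metric on the vectors of coefficients a and b.\<close>

definition h_metric :: "nat \<Rightarrow> complex \<Rightarrow> complex \<Rightarrow> complex \<Rightarrow> complex" where
  "h_metric m z a b = a * cnj b / of_real (max 1 (cmod z) ^ (2 * m))"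

definition h_T :: "complex \<Rightarrow> real" where
  "h_T z = 1 / max 1 (cmod z) ^ 4"

text \<open>\<open>(i / 2 pi) dz dzbar = (1 / pi) dx dy\<close>.\<close>

definition omega_inf :: "complex measure" where
  "omega_inf = density lborel (\<lambda>z. ennreal (1 / (pi * max 1 (cmod z) ^ 4)))"

definition L2_inner :: "nat \<Rightarrow> (complex \<Rightarrow> complex) \<Rightarrow> (complex \<Rightarrow> complex) \<Rightarrow> complex" where
  "L2_inner m \<xi> \<eta> = (LINT z|omega_inf. h_metric m z (\<xi> z) (\<eta> z))"

definition square_integrable :: "nat \<Rightarrow> (complex \<Rightarrow> complex) \<Rightarrow> bool" where
  "square_integrable m \<xi> \<longleftrightarrow>
     \<xi> \<in> borel_measurable omega_inf \<and> integrable omega_inf (\<lambda>z. h_metric m z (\<xi> z) (\<xi> z))"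

text \<open>
  The Hilbert completion of the smooth sections, realised as their closure in the complete space of
  square-integrable sections. Elements are representatives; those vanishing almost everywhere
  represent 0.
\<close>

definition hilbert_completion :: "nat \<Rightarrow> (complex \<Rightarrow> complex) set" where
  "hilbert_completion m =
     {\<phi>. square_integrable m \<phi> \<and>
          (\<exists>\<xi>. (\<forall>j. \<xi> j \<in> smooth_sections m) \<and>
               (\<lambda>j::nat. L2_inner m (\<lambda>z. \<phi> z - \<xi> j z) (\<lambda>z. \<phi> z - \<xi> j z)) \<longlonglongrightarrow> 0)}"


section \<open>The Laplacian and its spectrum\<close>

definition d_z :: "(complex \<Rightarrow> complex) \<Rightarrow> complex \<Rightarrow> complex" where
  "d_z f z = (frechet_derivative f (at z) 1 - \<i> * frechet_derivative f (at z) \<i>) / 2"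

definition d_zbar :: "(complex \<Rightarrow> complex) \<Rightarrow> complex \<Rightarrow> complex" where
  "d_zbar f z = (frechet_derivative f (at z) 1 + \<i> * frechet_derivative f (at z) \<i>) / 2"

text \<open>
  The Laplacian of \<open>f \<otimes> z^k\<close>. It is defined off the unit circle only, and the value 0 on that null
  set is a placeholder; likewise the formula is meaningless at the point \<open>z = 0\<close> when \<open>k > 0\<close>,
  where HOL's conventions return 0.
\<close>

definition laplacian_tensor :: "nat \<Rightarrow> (complex \<Rightarrow> complex) \<Rightarrow> nat \<Rightarrow> complex \<Rightarrow> complex" where
  "laplacian_tensor m f k =
     (\<lambda>z. if cmod z = 1 then 0
           else - (inverse (of_real (h_T z)) * inverse (h_metric m z (z ^ k) (z ^ k))
                   * d_z (\<lambda>u. h_metric m u (u ^ k) (u ^ k) * d_zbar f u) z)) \<otimes>z k"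

text \<open>
  Extension by linearity: every smooth section is a sum of tensors \<open>f_k \<otimes> z^k\<close> with smooth
  functions \<open>f_k\<close> on the projective line and k at most m. Such a decomposition is not unique, but
  away from the unit circle and 0 the result does not depend on it, whence the choice.
\<close>

definition decomposes :: "nat \<Rightarrow> (complex \<Rightarrow> complex) \<Rightarrow> (nat \<Rightarrow> complex \<Rightarrow> complex) \<Rightarrow> bool" where
  "decomposes m \<xi> f \<longleftrightarrow>
     (\<forall>k\<le>m. f k \<in> smooth_sections 0) \<and> \<xi> = (\<lambda>z. \<Sum>k\<le>m. (f k \<otimes>z k) z)"

definition laplacian :: "nat \<Rightarrow> (complex \<Rightarrow> complex) \<Rightarrow> complex \<Rightarrow> complex" where
  "laplacian m \<xi> =
     (let f = (SOME f. decomposes m \<xi> f) in (\<lambda>z. \<Sum>k\<le>m. laplacian_tensor m (f k) k z))"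

definition laplacian_spec :: "nat \<Rightarrow> complex set" where
  "laplacian_spec m =
     {\<alpha>. \<exists>\<phi>\<in>hilbert_completion m. \<not> (AE z in omega_inf. \<phi> z = 0) \<and>
          (\<forall>\<xi>\<in>smooth_sections m. L2_inner m \<phi> (laplacian m \<xi>) = \<alpha> * L2_inner m \<phi> \<xi>)}"


section \<open>Bessel functions and eigensections\<close>

definition bessel_J_nat :: "nat \<Rightarrow> complex \<Rightarrow> complex" where
  "bessel_J_nat n z = (\<Sum>j. (- 1) ^ j / (fact j * fact (j + n)) * (z / 2) ^ (2 * j + n))"

definition bessel_J :: "int \<Rightarrow> complex \<Rightarrow> complex" where
  "bessel_J n z =
     (if 0 \<le> n then bessel_J_nat (nat n) z else (- 1) ^ nat (- n) * bessel_J_nat (nat (- n)) z)"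

text \<open>Only the values at nonzero arguments matter here; the entire function extends these.\<close>

definition bessel_L :: "nat \<Rightarrow> int \<Rightarrow> complex \<Rightarrow> complex" where
  "bessel_L m n z =
     - (z ^ m) * deriv (\<lambda>w. w powi (- int m) * bessel_J n w * bessel_J (n - int m) w) z"

definition bessel_Z :: "nat \<Rightarrow> int \<Rightarrow> complex set" where
  "bessel_Z m n = {\<mu>. \<mu> \<noteq> 0 \<and> bessel_L m n \<mu> = 0}"

text \<open>
  With \<open>z = r e^{i theta}\<close>. For \<open>\<mu>\<close> in \<^term>\<open>bessel_Z m n\<close> (and, if \<open>m \<ge> 1\<close>, the Bessel
  functions of order n and n - m nonzero at \<open>\<mu>\<close>) the two branches agree on the unit circle. For
  \<open>m = 0\<close> the last case is that of \<open>J_n(\<mu>) = 0\<close>, since then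
  \<open>L_{0,n} = - 2 J_n J_n'\<close>.
\<close>

definition f_eigen :: "nat \<Rightarrow> int \<Rightarrow> complex \<Rightarrow> complex \<Rightarrow> complex" where
  "f_eigen m n \<mu> z =
     (let r = complex_of_real (cmod z); e = cis (of_int n * Arg z) in
      if m \<ge> 1 then
        (if cmod z < 1 then bessel_J n (\<mu> * r) * e
         else bessel_J n \<mu> / bessel_J (n - int m) \<mu> * r ^ m * bessel_J (n - int m) (\<mu> / r) * e)
      else if deriv (bessel_J n) \<mu> = 0 then
        (if cmod z < 1 then bessel_J n (\<mu> * r) * e else bessel_J n (\<mu> / r) * e)
      else
        (if cmod z < 1 then - bessel_J n (\<mu> * r) * e else bessel_J n (\<mu> / r) * e))"

definition phi_eigen :: "nat \<Rightarrow> int \<Rightarrow> complex \<Rightarrow> complex \<Rightarrow> complex" where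
  "phi_eigen m n \<mu> = f_eigen m n \<mu> \<otimes>z 0"

end

theory Submission
  imports Defs
begin

text \<open>
  In the frame \<open>1\<close> on \<open>|z| < 1\<close> and the frame \<open>z^m\<close> on \<open>|z| > 1\<close> (with coordinate \<open>w = 1/z\<close>) the
  canonical metrics are constant, so on each of the two open discs the Laplacian is
  \<open>- \<partial>\<partial>bar\<close> applied to the coefficient (\<open>laplacian_charts\<close>). A section is therefore handled as a
  pair \<open>(A, B)\<close> of functions on the unit disc, and the only question is what happens at the
  equator. If A and B are smooth and the section and its \<open>\<partial>bar\<close>-derivative are continuous across
  the equator, then Green's formula holds on the whole sphere without a boundary term
  (\<open>green_formula\<close>). Hence a section that satisfies \<open>\<partial>\<partial>bar = - \<alpha>\<close> on both discs and these two
  matching conditions is a weak eigensection with eigenvalue \<open>\<alpha>\<close> (\<open>weak_eigensection\<close>). Green's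
  formula comes from Stokes' theorem for \<open>(1,0)\<close>-forms that are merely continuous at the equator
  (\<open>stokes_sphere\<close>), which is proved in the plane by Fubini and the fundamental theorem of
  calculus along lines.

  The sections \<open>z^k\<close> are holomorphic, which gives the eigenvalue 0. The functions
  \<open>J_n(\<mu> r) e^{i n \<theta>}\<close> satisfy \<open>\<partial>\<partial>bar = - \<mu>^2/4\<close>, and \<open>\<partial>\<close>, \<open>\<partial>bar\<close> shift the order n by one. For
  the section with coefficients \<open>a J_n\<close> inside and \<open>b J_(m-n)\<close> outside, the two matching
  conditions are a homogeneous linear system in \<open>(a, b)\<close>, whose determinant equals \<open>L_{m,n}(\<mu>)\<close> up
  to sign (\<open>bessel_L_eq_det\<close>). So every \<open>\<mu>\<close> in \<open>Z_{m,n}\<close> gives a nonzero eigensection, and the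
  sections \<open>\<phi>_{n,\<mu>}\<close> are the solutions with a prescribed normalisation
  (\<open>phi_eigen_bessel_section\<close>). Such a section lies in the Hilbert completion because it is a
  fixed smooth section times a continuous function of the height on the sphere, which the
  Weierstrass theorem approximates by polynomials (\<open>radial_section_in_completion\<close>).
\<close>

section \<open>Wirtinger derivatives and smooth functions\<close>

definition has_wirtinger :: "(complex \<Rightarrow> complex) \<Rightarrow> complex \<Rightarrow> complex \<Rightarrow> complex \<Rightarrow> bool" where
  "has_wirtinger f p q z \<longleftrightarrow> (f has_derivative (\<lambda>v. p * v + q * cnj v)) (at z)"

lemma has_wirtinger_imp:
  assumes "has_wirtinger f p q z"
  shows "frechet_derivative f (at z) = (\<lambda>v. p * v + q * cnj v)" "d_z f z = p" "d_zbar f z = q"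
    "f differentiable (at z)"
proof -
  show *: "frechet_derivative f (at z) = (\<lambda>v. p * v + q * cnj v)"
    using assms frechet_derivative_at[of f "\<lambda>v. p * v + q * cnj v" z] by (auto simp: has_wirtinger_def)
  show "d_z f z = p" "d_zbar f z = q"
    by (simp_all add: d_z_def d_zbar_def * algebra_simps)
  show "f differentiable (at z)"
    using assms by (auto simp: has_wirtinger_def differentiable_def)
qed

lemma has_wirtinger_isCont: "has_wirtinger f p q z \<Longrightarrow> isCont f z"
  unfolding has_wirtinger_def by (rule has_derivative_continuous)

lemma real_linear_complex:
  assumes "bounded_linear (D :: complex \<Rightarrow> complex)"
  shows "D v = (D 1 - \<i> * D \<i>) / 2 * v + (D 1 + \<i> * D \<i>) / 2 * cnj v"
proof -
  interpret bounded_linear D by fact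
  have "D v = D (Re v *\<^sub>R 1 + Im v *\<^sub>R \<i>)"
    by (rule arg_cong[of _ _ D]) (simp add: complex_eq_iff)
  also have "\<dots> = Re v *\<^sub>R D 1 + Im v *\<^sub>R D \<i>" by (simp only: add scaleR)
  also have "\<dots> = (D 1 - \<i> * D \<i>) / 2 * v + (D 1 + \<i> * D \<i>) / 2 * cnj v"
    by (simp add: complex_eq_iff) (simp add: field_simps)
  finally show ?thesis .
qed

lemma differentiable_imp_has_wirtinger:
  assumes "f differentiable (at z)"
  shows "has_wirtinger f (d_z f z) (d_zbar f z) z"
proof -
  let ?D = "frechet_derivative f (at z)"
  have D: "(f has_derivative ?D) (at z)" using assms frechet_derivative_works by blast
  have "?D = (\<lambda>v. d_z f z * v + d_zbar f z * cnj v)"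
    unfolding d_z_def d_zbar_def
    by (rule ext) (rule real_linear_complex[OF has_derivative_bounded_linear[OF D]])
  thus ?thesis using D by (simp add: has_wirtinger_def)
qed

lemma has_wirtinger_cong:
  assumes "has_wirtinger f p q z" "open S" "z \<in> S" "\<And>u. u \<in> S \<Longrightarrow> f u = g u"
  shows "has_wirtinger g p q z"
  using assms has_derivative_transform_within_open unfolding has_wirtinger_def by blast

lemma has_wirtinger_holomorphic:
  assumes "(f has_field_derivative f') (at z)"
  shows "has_wirtinger f f' 0 z"
  using assms by (simp add: has_wirtinger_def has_field_derivative_def)

lemma has_wirtinger_const: "has_wirtinger (\<lambda>_. c) 0 0 z"
  by (simp add: has_wirtinger_def)

lemma has_wirtinger_id: "has_wirtinger (\<lambda>z. z) 1 0 z"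
  by (simp add: has_wirtinger_def)

lemma has_wirtinger_power:
  "has_wirtinger (\<lambda>z. z ^ k) (of_nat k * z ^ (k - 1)) 0 z"
  by (rule has_wirtinger_holomorphic) (auto intro!: derivative_eq_intros)

lemma has_wirtinger_cnj:
  assumes "has_wirtinger f p q z"
  shows "has_wirtinger (\<lambda>z. cnj (f z)) (cnj q) (cnj p) z"
  using has_derivative_cnj[OF assms[unfolded has_wirtinger_def]]
  by (simp add: has_wirtinger_def add.commute)

lemma has_wirtinger_add:
  assumes "has_wirtinger f p q z" "has_wirtinger g p' q' z"
  shows "has_wirtinger (\<lambda>z. f z + g z) (p + p') (q + q') z"
  using has_derivative_add[OF assms[unfolded has_wirtinger_def]]
  by (simp add: has_wirtinger_def algebra_simps)

lemma has_wirtinger_mult: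
  assumes "has_wirtinger f p q z" "has_wirtinger g p' q' z"
  shows "has_wirtinger (\<lambda>z. f z * g z) (f z * p' + p * g z) (f z * q' + q * g z) z"
  using has_derivative_mult[OF assms[unfolded has_wirtinger_def]]
  by (simp add: has_wirtinger_def algebra_simps)

lemma has_wirtinger_minus:
  assumes "has_wirtinger f p q z"
  shows "has_wirtinger (\<lambda>z. - f z) (- p) (- q) z"
  using has_wirtinger_mult[OF has_wirtinger_const[of "-1"] assms] by simp

lemma has_wirtinger_sum:
  assumes "\<And>i. i \<in> I \<Longrightarrow> has_wirtinger (f i) (p i) (q i) z"
  shows "has_wirtinger (\<lambda>z. \<Sum>i\<in>I. f i z) (\<Sum>i\<in>I. p i) (\<Sum>i\<in>I. q i) z"
  using assms by (induction I rule: infinite_finite_induct)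
    (auto intro!: has_wirtinger_add simp: has_wirtinger_const)

lemma has_wirtinger_compose_holomorphic:
  assumes "has_wirtinger f p q z" "(g has_field_derivative g') (at (f z))"
  shows "has_wirtinger (\<lambda>z. g (f z)) (g' * p) (g' * q) z"
  using has_derivative_compose[OF assms(1)[unfolded has_wirtinger_def]
      assms(2)[unfolded has_field_derivative_def]]
  by (simp add: has_wirtinger_def algebra_simps)

lemma has_wirtinger_inversion:
  assumes "has_wirtinger g p q (1 / z)" "z \<noteq> 0"
  shows "has_wirtinger (\<lambda>z. g (1 / z)) (- p / z\<^sup>2) (- q / (cnj z)\<^sup>2) z"
proof -
  have "((\<lambda>z. 1 / z) has_field_derivative - (1 / z\<^sup>2)) (at z)"
    using assms(2) by (auto intro!: derivative_eq_intros simp: power2_eq_square)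
  moreover have "(*) (- (1 / z\<^sup>2)) = (\<lambda>v. - (1 / z\<^sup>2) * v)" ..
  ultimately have "((\<lambda>z. 1 / z) has_derivative (\<lambda>v. - (1 / z\<^sup>2) * v)) (at z)"
    unfolding has_field_derivative_def by metis
  from has_derivative_compose[OF this assms(1)[unfolded has_wirtinger_def]]
  show ?thesis by (simp add: has_wirtinger_def)
qed

lemma cont_diff_Suc_imp: "cont_diff (Suc k) f \<Longrightarrow> cont_diff k f"
proof (induction k arbitrary: f)
  case 0
  thus ?case by (simp add: continuous_at_imp_continuous_on differentiable_imp_continuous_within)
next
  case (Suc k)
  thus ?case unfolding cont_diff.simps(2)[of "Suc k" f] cont_diff.simps(2)[of k f] by blast
qed

lemma cont_diff_const: "cont_diff k (\<lambda>_. c)"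
  by (induction k arbitrary: c) auto

lemma cont_diff_add: "cont_diff k f \<Longrightarrow> cont_diff k g \<Longrightarrow> cont_diff k (\<lambda>z. f z + g z)"
proof (induction k arbitrary: f g)
  case 0
  thus ?case by (simp add: continuous_on_add continuous_on_mult continuous_on_cnj)
next
  case (Suc k)
  have "frechet_derivative (\<lambda>z. f z + g z) (at z)
      = (\<lambda>v. frechet_derivative f (at z) v + frechet_derivative g (at z) v)" for z
    using Suc.prems by (intro frechet_derivative_at[symmetric] derivative_intros)
      (auto simp: frechet_derivative_works[symmetric])
  thus ?case using Suc by auto
qed

lemma cont_diff_cmult: "cont_diff k f \<Longrightarrow> cont_diff k (\<lambda>z. c * f z)"
proof (induction k arbitrary: f)
  case 0
  thus ?case by (simp add: continuous_on_add continuous_on_mult continuous_on_cnj)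
next
  case (Suc k)
  have "frechet_derivative (\<lambda>z. c * f z) (at z)
      = (\<lambda>v. c * frechet_derivative f (at z) v)" for z
    using Suc.prems by (intro frechet_derivative_at[symmetric] derivative_intros)
      (auto simp: frechet_derivative_works[symmetric])
  thus ?case using Suc by auto
qed

lemma cont_diff_SucI:
  assumes "\<And>z. has_wirtinger f (p z) (q z) z" "cont_diff k p" "cont_diff k q"
  shows "cont_diff (Suc k) f"
proof -
  have "cont_diff k (\<lambda>z. frechet_derivative f (at z) v)" for v
  proof -
    have "(\<lambda>z. frechet_derivative f (at z) v) = (\<lambda>z. v * p z + cnj v * q z)"
      by (simp add: has_wirtinger_imp(1)[OF assms(1)] mult.commute)
    thus ?thesis using cont_diff_add[OF cont_diff_cmult[OF assms(2)] cont_diff_cmult[OF assms(3)]]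
      by simp
  qed
  thus ?thesis using has_wirtinger_imp(4)[OF assms(1)] by auto
qed

lemma cont_diff_SucE:
  assumes "cont_diff (Suc k) f"
  shows "has_wirtinger f (d_z f z) (d_zbar f z) z" "cont_diff k (d_z f)" "cont_diff k (d_zbar f)"
proof -
  show "has_wirtinger f (d_z f z) (d_zbar f z) z"
    using assms by (intro differentiable_imp_has_wirtinger) auto
  have D: "cont_diff k (\<lambda>z. frechet_derivative f (at z) v)" for v using assms by simp
  have "d_z f = (\<lambda>z. 1/2 * frechet_derivative f (at z) 1 + (-\<i>/2) * frechet_derivative f (at z) \<i>)"
    by (auto simp: d_z_def field_simps)
  thus "cont_diff k (d_z f)"
    by (simp only:) (intro cont_diff_add cont_diff_cmult D)
  have "d_zbar f = (\<lambda>z. 1/2 * frechet_derivative f (at z) 1 + (\<i>/2) * frechet_derivative f (at z) \<i>)"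
    by (auto simp: d_zbar_def field_simps)
  thus "cont_diff k (d_zbar f)"
    by (simp only:) (intro cont_diff_add cont_diff_cmult D)
qed

lemma cont_diff_mult: "cont_diff k f \<Longrightarrow> cont_diff k g \<Longrightarrow> cont_diff k (\<lambda>z. f z * g z)"
proof (induction k arbitrary: f g)
  case 0
  thus ?case by (simp add: continuous_on_add continuous_on_mult continuous_on_cnj)
next
  case (Suc k)
  note f = cont_diff_SucE[OF Suc.prems(1)] cont_diff_Suc_imp[OF Suc.prems(1)]
  note g = cont_diff_SucE[OF Suc.prems(2)] cont_diff_Suc_imp[OF Suc.prems(2)]
  show ?case
    by (rule cont_diff_SucI[OF has_wirtinger_mult[OF f(1) g(1)]])
      (intro cont_diff_add Suc.IH f g)+
qed

lemma cont_diff_cnj: "cont_diff k f \<Longrightarrow> cont_diff k (\<lambda>z. cnj (f z))"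
proof (induction k arbitrary: f)
  case 0
  thus ?case by (simp add: continuous_on_add continuous_on_mult continuous_on_cnj)
next
  case (Suc k)
  note f = cont_diff_SucE[OF Suc.prems(1)]
  show ?case
    by (rule cont_diff_SucI[OF has_wirtinger_cnj[OF f(1)]]) (intro Suc.IH f)+
qed

lemma cont_diff_inverse:
  assumes "\<And>z. f z \<noteq> 0"
  shows "cont_diff k f \<Longrightarrow> cont_diff k (\<lambda>z. inverse (f z))"
proof (induction k)
  case 0
  thus ?case by (simp add: continuous_on_inverse assms)
next
  case (Suc k)
  note f = cont_diff_SucE[OF Suc.prems]
  have I: "cont_diff k (\<lambda>z. inverse (f z))" by (rule Suc.IH[OF cont_diff_Suc_imp[OF Suc.prems]])
  have W: "has_wirtinger (\<lambda>z. inverse (f z)) (- (inverse (f z) * inverse (f z)) * d_z f z)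
      (- (inverse (f z) * inverse (f z)) * d_zbar f z) z" for z
    by (rule has_wirtinger_compose_holomorphic[OF f(1)])
      (use DERIV_inverse[OF assms[of z]] in simp)
  have "cont_diff k (\<lambda>z. - (inverse (f z) * inverse (f z)))"
    using cont_diff_cmult[OF cont_diff_mult[OF I I], of "-1"] by simp
  thus ?case by (intro cont_diff_SucI[OF W] cont_diff_mult f)
qed

lemma smooth_const: "smooth (\<lambda>_. c)"
  by (simp add: smooth_def cont_diff_const del: cont_diff.simps)

lemma smooth_id: "smooth (\<lambda>z. z)"
  unfolding smooth_def
proof
  fix k
  show "cont_diff k (\<lambda>z::complex. z)"
    by (rule cont_diff_Suc_imp, intro cont_diff_SucI[of _ "\<lambda>_. 1" "\<lambda>_. 0"] has_wirtinger_id cont_diff_const)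
qed

lemma smooth_add: "smooth f \<Longrightarrow> smooth g \<Longrightarrow> smooth (\<lambda>z. f z + g z)"
  and smooth_mult: "smooth f \<Longrightarrow> smooth g \<Longrightarrow> smooth (\<lambda>z. f z * g z)"
  and smooth_cnj: "smooth f \<Longrightarrow> smooth (\<lambda>z. cnj (f z))"
  by (simp_all only: smooth_def cont_diff_add cont_diff_mult cont_diff_cnj simp_thms)

lemma smooth_minus: "smooth f \<Longrightarrow> smooth (\<lambda>z. - f z)"
  using smooth_mult[OF smooth_const[of "-1"], of f] by simp

lemma smooth_divide:
  "smooth f \<Longrightarrow> smooth g \<Longrightarrow> (\<And>z. g z \<noteq> 0) \<Longrightarrow> smooth (\<lambda>z. f z / g z)"
  unfolding divide_inverse by (intro smooth_mult) (simp_all only: smooth_def cont_diff_inverse simp_thms)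

lemma smooth_power: "smooth f \<Longrightarrow> smooth (\<lambda>z. f z ^ k)"
  by (induction k) (simp_all add: smooth_const smooth_mult)

lemma smooth_sum: "(\<And>i. i \<in> I \<Longrightarrow> smooth (f i)) \<Longrightarrow> smooth (\<lambda>z. \<Sum>i\<in>I. f i z)"
  by (induction I rule: infinite_finite_induct) (simp_all add: smooth_const smooth_add)

lemma smooth_has_wirtinger: "smooth f \<Longrightarrow> has_wirtinger f (d_z f z) (d_zbar f z) z"
  by (rule cont_diff_SucE(1)[of 0]) (simp only: smooth_def)

lemma smooth_d_z: "smooth f \<Longrightarrow> smooth (d_z f)"
  and smooth_d_zbar: "smooth f \<Longrightarrow> smooth (d_zbar f)"
  by (simp_all only: smooth_def cont_diff_SucE simp_thms)

lemmas smooth_intros = smooth_const smooth_id smooth_add smooth_mult smooth_cnj smooth_minus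
  smooth_divide smooth_power smooth_sum smooth_d_z smooth_d_zbar

lemma smooth_continuous_on: "smooth f \<Longrightarrow> continuous_on S f"
  by (rule continuous_on_subset[OF _ subset_UNIV]) (simp only: smooth_def cont_diff.simps(1)[symmetric])

lemma smooth_borel: "smooth f \<Longrightarrow> f \<in> borel_measurable borel"
  by (intro borel_measurable_continuous_onI smooth_continuous_on)

section \<open>Stokes' theorem on the sphere\<close>

lemma measurable_Complex [measurable]:
  "(\<lambda>p. Complex (fst p) (snd p)) \<in> borel_measurable (borel :: (real \<times> real) measure)"
  by (intro borel_measurable_continuous_onI) (auto simp: Complex_eq intro!: continuous_intros)

lemma distr_lborel_Complex:
  "distr (lborel :: (real \<times> real) measure) borel (\<lambda>p. Complex (fst p) (snd p)) = lborel"
proof (rule lborel_eqI[symmetric])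
  fix l u :: complex
  assume le: "\<And>b. b \<in> Basis \<Longrightarrow> l \<bullet> b \<le> u \<bullet> b"
  have box: "box (a, b) (c, d) = {a<..<c} \<times> {b<..<d}" for a b c d :: real
    by (auto simp: box_def Basis_prod_def)
  have vim: "(\<lambda>p. Complex (fst p) (snd p)) -` box l u = box (Re l, Im l) (Re u, Im u)"
    by (auto simp: in_box_complex_iff box)
  have "emeasure (distr lborel borel (\<lambda>p. Complex (fst p) (snd p))) (box l u)
      = emeasure lborel (box (Re l, Im l) (Re u, Im u))"
    by (subst emeasure_distr) (simp_all add: vim)
  also have "\<dots> = ennreal ((Re u - Re l) * (Im u - Im l))"
    using le[of 1] le[of \<i>]
    by (subst emeasure_lborel_box) (auto simp: Basis_prod_def Basis_complex_def
        prod.union_disjoint image_image)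
  finally show "emeasure (distr lborel borel (\<lambda>p. Complex (fst p) (snd p))) (box l u)
      = (\<Prod>b\<in>Basis. (u - l) \<bullet> b)"
    by (simp add: Basis_complex_def)
qed simp

lemma
  fixes f :: "complex \<Rightarrow> 'a :: {banach, second_countable_topology}"
  assumes [measurable]: "f \<in> borel_measurable borel"
  shows integrable_lborel_complex_iff:
      "integrable lborel f \<longleftrightarrow> integrable (lborel \<Otimes>\<^sub>M lborel) (\<lambda>(x, y). f (Complex x y))"
    and integral_lborel_complex:
      "integral\<^sup>L lborel f = integral\<^sup>L (lborel \<Otimes>\<^sub>M lborel) (\<lambda>(x, y). f (Complex x y))"
proof -
  have m: "(\<lambda>p. Complex (fst p) (snd p)) \<in> measurable lborel borel" by simp
  show "integrable lborel f \<longleftrightarrow> integrable (lborel \<Otimes>\<^sub>M lborel) (\<lambda>(x, y). f (Complex x y))"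
    by (subst distr_lborel_Complex[symmetric], subst integrable_distr_eq[OF m assms])
      (simp add: lborel_prod case_prod_unfold)
  show "integral\<^sup>L lborel f = integral\<^sup>L (lborel \<Otimes>\<^sub>M lborel) (\<lambda>(x, y). f (Complex x y))"
    by (subst distr_lborel_Complex[symmetric], subst integral_distr[OF m assms])
      (simp add: lborel_prod case_prod_unfold)
qed

lemma integrable_line_weight: "integrable lborel (\<lambda>x::real. (1 + \<bar>x\<bar>) powr (-3/2))"
proof -
  let ?f = "\<lambda>x::real. (1 + x) powr (-3/2)"
  have lim: "((\<lambda>x::real. - 2 * (1 + x) powr (-1/2)) \<longlongrightarrow> 0) at_top"
    by (intro tendsto_mult_right_zero tendsto_neg_powr filterlim_tendsto_add_at_top[OF tendsto_const] filterlim_ident) auto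
  have "(\<integral>\<^sup>+x. ennreal (?f x) * indicator {0..} x \<partial>lborel) = ennreal (0 - (- 2 * (1 + 0) powr (-1/2)))"
    by (rule nn_integral_FTC_atLeast[OF _ _ _ lim])
      (auto intro!: derivative_eq_intros simp: powr_diff field_simps)
  hence "(\<integral>\<^sup>+x. ennreal (norm (indicator {0..} x * ?f x)) \<partial>lborel) < \<infinity>"
    by (subst nn_integral_cong[where v = "\<lambda>x. ennreal (?f x) * indicator {0..} x"])
      (auto split: split_indicator)
  hence I: "integrable lborel (\<lambda>x. indicator {0..} x * ?f x)"
    by (intro integrableI_bounded) auto
  have J: "integrable lborel (\<lambda>x. indicator {0..} (- x) * ?f (- x))"
    using lborel_integrable_real_affine[OF I, of "-1" 0] by simp
  show ?thesis
    by (rule Bochner_Integration.integrable_bound[OF Bochner_Integration.integrable_add[OF I J]])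
      (auto split: split_indicator)
qed

text \<open>The weight is dominated by a product of functions of the real and of the imaginary part.\<close>

lemma integrable_plane_weight: "integrable lborel (\<lambda>z::complex. 1 / max 1 (cmod z) ^ 3)"
proof -
  let ?g = "\<lambda>x::real. (1 + \<bar>x\<bar>) powr (-3/2)"
  have "integrable (lborel \<Otimes>\<^sub>M lborel) (\<lambda>(x, y). ?g x * ?g y)"
  proof (rule lborel_pair.Fubini_integrable)
    show "AE x in lborel. integrable lborel (\<lambda>y. case (x, y) of (x, y) \<Rightarrow> ?g x * ?g y)"
      using integrable_line_weight by simp
    show "integrable lborel (\<lambda>x. LINT y|lborel. norm (case (x, y) of (x, y) \<Rightarrow> ?g x * ?g y))"
      using integrable_line_weight by (simp add: abs_mult)
  qed measurable
  moreover have "(\<lambda>(x, y). ?g x * ?g y) = (\<lambda>(x, y). ?g (Re (Complex x y)) * ?g (Im (Complex x y)))"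
    by simp
  ultimately have I: "integrable lborel (\<lambda>z. ?g (Re z) * ?g (Im z))"
    by (subst integrable_lborel_complex_iff) auto
  show ?thesis
  proof (rule Bochner_Integration.integrable_bound[OF integrable_mult_right[OF I, of 8]])
    show "AE z in lborel. norm (1 / max 1 (cmod z) ^ 3) \<le> norm (8 * (?g (Re z) * ?g (Im z)))"
    proof (rule AE_I2)
      fix z :: complex
      define M where "M = max 1 (cmod z)"
      have M: "M \<ge> 1" by (simp add: M_def)
      have "1 + \<bar>Re z\<bar> \<le> 2 * M" "1 + \<bar>Im z\<bar> \<le> 2 * M"
        using abs_Re_le_cmod[of z] abs_Im_le_cmod[of z] by (auto simp: M_def)
      hence "(1 + \<bar>Re z\<bar>) * (1 + \<bar>Im z\<bar>) \<le> (2 * M) * (2 * M)"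
        using M by (intro mult_mono) auto
      hence "((2 * M) * (2 * M)) powr (-3/2) \<le> ((1 + \<bar>Re z\<bar>) * (1 + \<bar>Im z\<bar>)) powr (-3/2)"
        using M by (intro powr_mono2') (auto intro!: mult_pos_pos)
      also have "((2 * M) * (2 * M)) powr (-3/2) = (2 * M) powr (- 3)"
      proof -
        have "(2 * M) * (2 * M) = (2 * M) powr 2" using M by (simp add: powr_numeral power2_eq_square)
        thus ?thesis by (simp only: powr_powr) simp
      qed
      also have "\<dots> = 1 / (8 * M ^ 3)"
        using M by (simp add: powr_minus_divide powr_numeral power_mult_distrib)
      also have "((1 + \<bar>Re z\<bar>) * (1 + \<bar>Im z\<bar>)) powr (-3/2) = ?g (Re z) * ?g (Im z)"
        by (simp add: powr_mult)
      finally have "1 / M ^ 3 \<le> 8 * (?g (Re z) * ?g (Im z))"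
        using M by (simp add: field_simps)
      thus "norm (1 / max 1 (cmod z) ^ 3) \<le> norm (8 * (?g (Re z) * ?g (Im z)))"
        by (simp add: M_def)
    qed
  qed measurable
qed

lemma integral_line_derivative_zero:
  fixes g g' :: "real \<Rightarrow> complex"
  assumes "finite S" and cont: "continuous_on UNIV g"
    and der: "\<And>x. x \<notin> S \<Longrightarrow> (g has_vector_derivative g' x) (at x)"
    and int: "integrable lborel g'"
    and lim: "(g \<longlongrightarrow> 0) at_top" "(g \<longlongrightarrow> 0) at_bot"
  shows "integral\<^sup>L lborel g' = 0"
proof -
  have [measurable]: "g' \<in> borel_measurable borel" using int by auto
  have eq: "(LINT x|lborel. indicator {- real n..real n} x *\<^sub>R g' x) = g (real n) - g (- real n)" for n
  proof -
    have si: "set_integrable lborel {- real n..real n} g'"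
      using int unfolding set_integrable_def by (intro integrable_mult_indicator) auto
    have "(g' has_integral (g (real n) - g (- real n))) {- real n..real n}"
      by (rule fundamental_theorem_of_calculus_interior_strong[OF \<open>finite S\<close>])
        (use der continuous_on_subset[OF cont] in auto)
    thus ?thesis
      using set_borel_integral_eq_integral[OF si]
      by (simp add: set_lebesgue_integral_def integral_unique)
  qed
  have "(\<lambda>n. g (real n) - g (- real n)) \<longlonglongrightarrow> 0 - 0"
  proof (intro tendsto_diff)
    show "(\<lambda>n. g (real n)) \<longlonglongrightarrow> 0"
      by (rule filterlim_compose[OF lim(1) filterlim_real_sequentially])
    show "(\<lambda>n. g (- real n)) \<longlonglongrightarrow> 0"
      by (rule filterlim_compose[OF lim(2)])
        (use filterlim_real_sequentially in \<open>simp add: filterlim_uminus_at_top\<close>)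
  qed
  moreover have "(\<lambda>n. LINT x|lborel. indicator {- real n..real n} x *\<^sub>R g' x) \<longlonglongrightarrow> integral\<^sup>L lborel g'"
  proof (rule integral_dominated_convergence[where w = "\<lambda>x. norm (g' x)"])
    show "AE x in lborel. (\<lambda>n. indicator {- real n..real n} x *\<^sub>R g' x) \<longlonglongrightarrow> g' x"
    proof (rule AE_I2)
      fix x :: real
      obtain N :: nat where N: "\<bar>x\<bar> \<le> real N" using real_arch_simple by blast
      show "(\<lambda>n. indicator {- real n..real n} x *\<^sub>R g' x) \<longlonglongrightarrow> g' x"
        by (intro tendsto_eventually eventually_sequentiallyI[of N])
          (use N in \<open>auto simp: indicator_def\<close>)
    qed
    show "AE x in lborel. norm (indicator {- real n..real n} x *\<^sub>R g' x) \<le> norm (g' x)" for n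
      by (auto split: split_indicator)
  qed (use int in auto)
  ultimately show ?thesis unfolding eq by (simp add: LIMSEQ_unique)
qed

lemma finite_circle_slice:
  "finite {x::real. x\<^sup>2 + y\<^sup>2 = 1}"
proof -
  have "{x::real. x\<^sup>2 + y\<^sup>2 = 1} \<subseteq> {sqrt (1 - y\<^sup>2), - sqrt (1 - y\<^sup>2)}"
  proof
    fix x assume "x \<in> {x::real. x\<^sup>2 + y\<^sup>2 = 1}"
    hence "sqrt (1 - y\<^sup>2) = \<bar>x\<bar>" by (simp flip: real_sqrt_abs add: algebra_simps)
    thus "x \<in> {sqrt (1 - y\<^sup>2), - sqrt (1 - y\<^sup>2)}" by auto
  qed
  thus ?thesis by (rule finite_subset) simp
qed

text \<open>
  Fubini's theorem reduces the statement to the vanishing of the integral of a derivative along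
  each horizontal and each vertical line. Such a line meets the unit circle in at most two points,
  where continuity suffices, so no boundary integral ever appears.
\<close>

lemma integral_d_zbar_zero:
  assumes cont: "continuous_on UNIV F"
    and der: "\<And>z. cmod z \<noteq> 1 \<Longrightarrow> has_wirtinger F (p z) (q z) z"
    and int: "integrable lborel p" "integrable lborel q"
    and lim: "(F \<longlongrightarrow> 0) at_infinity"
  shows "integral\<^sup>L lborel q = 0"
proof -
  have inf: "filterlim (\<lambda>x. Complex x y) at_infinity F1" "filterlim (\<lambda>x. Complex y x) at_infinity F1"
    if "filterlim (\<lambda>x::real. \<bar>x\<bar>) at_top F1" for y F1
    unfolding filterlim_at_infinity_conv_norm_at_top
    using filterlim_at_top_mono[OF that] abs_Re_le_cmod[of "Complex _ y"] abs_Im_le_cmod[of "Complex y _"]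
    by (auto intro!: always_eventually)
  have top: "filterlim (\<lambda>x::real. \<bar>x\<bar>) at_top at_top" by (rule filterlim_abs_real)
  have bot: "filterlim (\<lambda>x::real. \<bar>x\<bar>) at_top at_bot"
    using filterlim_compose[OF filterlim_abs_real filterlim_uminus_at_top_at_bot] by simp
  have off: "has_wirtinger F (p z) (q z) z" if "(Re z)\<^sup>2 + (Im z)\<^sup>2 \<noteq> 1" for z
    using that by (intro der) (auto simp: cmod_def)
  have c: "continuous_on UNIV (\<lambda>x. F (Complex x y))" "continuous_on UNIV (\<lambda>x. F (Complex y x))" for y
    by (auto simp: Complex_eq intro!: continuous_intros continuous_on_compose2[OF cont])
  have [measurable]: "p \<in> borel_measurable borel" "q \<in> borel_measurable borel" using int by auto
  define a b where "a = (\<lambda>z. p z + q z)" and "b = (\<lambda>z. \<i> * (p z - q z))"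
  have [measurable]: "a \<in> borel_measurable borel" "b \<in> borel_measurable borel"
    unfolding a_def b_def by measurable
  have ia: "integrable lborel a" and ib: "integrable lborel b"
    unfolding a_def b_def using int by auto
  have ia': "integrable (lborel \<Otimes>\<^sub>M lborel) (\<lambda>(x, y). a (Complex x y))"
    using ia by (simp add: integrable_lborel_complex_iff)
  have ib': "integrable (lborel \<Otimes>\<^sub>M lborel) (\<lambda>(x, y). b (Complex x y))"
    using ib by (simp add: integrable_lborel_complex_iff)
  have da: "((\<lambda>x. F (Complex x y)) has_vector_derivative a (Complex x y)) (at x)"
    if "x\<^sup>2 + y\<^sup>2 \<noteq> 1" for x y
  proof -
    have "((\<lambda>x. Complex x y) has_derivative (\<lambda>h. of_real h)) (at x)"
      unfolding Complex_eq by (auto intro!: derivative_eq_intros)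
    from has_derivative_compose[OF this off[of "Complex x y", unfolded has_wirtinger_def]] that
    show ?thesis by (simp add: has_vector_derivative_def a_def scaleR_conv_of_real algebra_simps)
  qed
  have db: "((\<lambda>y. F (Complex x y)) has_vector_derivative b (Complex x y)) (at y)"
    if "x\<^sup>2 + y\<^sup>2 \<noteq> 1" for x y
  proof -
    have "((\<lambda>y. Complex x y) has_derivative (\<lambda>h. \<i> * of_real h)) (at y)"
      unfolding Complex_eq by (auto intro!: derivative_eq_intros)
    from has_derivative_compose[OF this off[of "Complex x y", unfolded has_wirtinger_def]] that
    show ?thesis by (simp add: has_vector_derivative_def b_def scaleR_conv_of_real algebra_simps)
  qed
  have "AE y in lborel. (LINT x|lborel. a (Complex x y)) = 0"
  proof (rule AE_mp[OF lborel_pair.AE_integrable_snd[OF ia']], rule AE_I2, rule impI)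
    fix y :: real assume "integrable lborel (\<lambda>x. a (Complex x y))"
    thus "(LINT x|lborel. a (Complex x y)) = 0"
      by (intro integral_line_derivative_zero[OF finite_circle_slice[of y] c(1) da]
          filterlim_compose[OF lim inf(1)] top bot) auto
  qed
  hence "(LINT y|lborel. LINT x|lborel. a (Complex x y)) = 0"
    by (rule integral_eq_zero_AE)
  hence A: "integral\<^sup>L lborel a = 0"
    using lborel_pair.integral_snd[OF ia'] by (simp add: integral_lborel_complex)
  have "AE x in lborel. (LINT y|lborel. b (Complex x y)) = 0"
  proof (rule AE_mp[OF lborel_pair.AE_integrable_fst[OF ib']], rule AE_I2, rule impI)
    fix x :: real assume "integrable lborel (\<lambda>y. b (Complex x y))"
    thus "(LINT y|lborel. b (Complex x y)) = 0"
      by (intro integral_line_derivative_zero[OF finite_circle_slice[of x] c(2) db]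
          filterlim_compose[OF lim inf(2)] top bot) (auto simp: add.commute)
  qed
  hence "(LINT x|lborel. LINT y|lborel. b (Complex x y)) = 0"
    by (rule integral_eq_zero_AE)
  hence B: "integral\<^sup>L lborel b = 0"
    using lborel_pair.integral_fst[OF ib'] by (simp add: integral_lborel_complex)
  have "integral\<^sup>L lborel p + integral\<^sup>L lborel q = 0" "integral\<^sup>L lborel p - integral\<^sup>L lborel q = 0"
    using A B int by (simp_all add: a_def b_def)
  thus ?thesis by simp
qed

text \<open>
  A density on the sphere given by its coefficients with respect to the Lebesgue measures of the two
  coordinate discs; \<open>|z|^-4\<close> is the Jacobian determinant of \<open>z \<mapsto> 1/z\<close>.
\<close>

definition two_charts :: "(complex \<Rightarrow> complex) \<Rightarrow> (complex \<Rightarrow> complex) \<Rightarrow> complex \<Rightarrow> complex" where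
  "two_charts U V z = (if cmod z < 1 then U z else V (1 / z) / of_real (cmod z ^ 4))"

lemma integrable_split_disc:
  fixes U V c :: "complex \<Rightarrow> complex"
  assumes cont: "continuous_on UNIV U" "continuous_on UNIV V"
    and c [measurable]: "c \<in> borel_measurable borel"
    and le: "\<And>z. cmod z \<ge> 1 \<Longrightarrow> norm (c z) \<le> 1 / cmod z ^ 3"
  shows "integrable lborel (\<lambda>z. if cmod z < 1 then U z else c z * V (1 / z))"
proof -
  have [measurable]: "U \<in> borel_measurable borel" "V \<in> borel_measurable borel"
    using cont by (simp_all only: borel_measurable_continuous_onI)
  have bd: "\<exists>B>0. \<forall>z\<in>cball 0 1. norm (W z) \<le> B" if "continuous_on UNIV W" for W :: "complex \<Rightarrow> complex"
  proof -
    have "compact (W ` cball 0 1)"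
      by (rule compact_continuous_image[OF continuous_on_subset[OF that subset_UNIV] compact_cball])
    hence "bounded (W ` cball 0 1)" by (rule compact_imp_bounded)
    thus ?thesis unfolding bounded_pos by (simp only: ball_simps)
  qed
  from bd[OF cont(1)] obtain B where "B > 0" and B: "\<And>z. z \<in> cball 0 1 \<Longrightarrow> norm (U z) \<le> B" by metis
  from bd[OF cont(2)] obtain B' where B': "\<And>z. z \<in> cball 0 1 \<Longrightarrow> norm (V z) \<le> B'" by metis
  define C where "C = max B B'"
  have C: "B \<le> C" "B' \<le> C" "C > 0" using \<open>B > 0\<close> by (auto simp: C_def)
  show ?thesis
  proof (rule Bochner_Integration.integrable_bound[OF
        integrable_mult_right[OF integrable_plane_weight, of C]])
    show "AE z in lborel. norm (if cmod z < 1 then U z else c z * V (1 / z))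
        \<le> norm (C * (1 / max 1 (cmod z) ^ 3))"
    proof (rule AE_I2)
      fix z :: complex
      have "norm (if cmod z < 1 then U z else c z * V (1 / z)) \<le> C * (1 / max 1 (cmod z) ^ 3)"
      proof (cases "cmod z < 1")
        case True
        hence "norm (U z) \<le> C" using B[of z] C by simp
        thus ?thesis using True by simp
      next
        case False
        hence "norm (V (1 / z)) \<le> B'" by (intro B') (simp add: norm_divide divide_le_eq)
        hence "norm (c z) * norm (V (1 / z)) \<le> (1 / cmod z ^ 3) * C"
          using le[of z] False C by (intro mult_mono) simp_all
        thus ?thesis using False by (simp add: norm_mult)
      qed
      also have "\<dots> = norm (C * (1 / max 1 (cmod z) ^ 3))" using C by simp
      finally show "norm (if cmod z < 1 then U z else c z * V (1 / z))
        \<le> norm (C * (1 / max 1 (cmod z) ^ 3))" .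
    qed
  qed measurable
qed

lemma integrable_two_charts:
  assumes "continuous_on UNIV U" "continuous_on UNIV V"
  shows "integrable lborel (two_charts U V)"
proof -
  have "integrable lborel (\<lambda>z. if cmod z < 1 then U z else (1 / of_real (cmod z ^ 4)) * V (1 / z))"
  proof (rule integrable_split_disc[OF assms])
    fix z :: complex assume z: "cmod z \<ge> 1"
    hence "cmod z ^ 3 \<le> cmod z ^ 4" "0 < cmod z ^ 3" by (auto intro: power_increasing)
    hence "1 / cmod z ^ 4 \<le> 1 / cmod z ^ 3" by (intro divide_left_mono) auto
    thus "norm (1 / complex_of_real (cmod z ^ 4)) \<le> 1 / cmod z ^ 3"
      by (simp add: norm_divide norm_power)
  qed measurable
  thus ?thesis by (simp add: two_charts_def[abs_def] cong: if_cong)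
qed

text \<open>
  On the sphere, \<open>F0\<close> and \<open>- G\<close> are the coefficients in the two charts of a form of type
  \<open>(1,0)\<close> that is continuous and smooth off the equator; its exterior derivative integrates to 0.
\<close>

lemma stokes_sphere:
  assumes F0: "smooth F0" and G: "smooth G"
    and match: "\<And>z. cmod z = 1 \<Longrightarrow> F0 z = G (1 / z) / z\<^sup>2"
  shows "integral\<^sup>L lborel (two_charts (d_zbar F0) (\<lambda>w. - d_zbar G w)) = 0"
proof -
  define F where "F = (\<lambda>z. if cmod z < 1 then F0 z else G (1 / z) / z\<^sup>2)"
  define p where "p = (\<lambda>z. if cmod z < 1 then d_z F0 z
      else (1 / z ^ 3) * (\<lambda>w. - 2 * G w - w * d_z G w) (1 / z))"
  define q where "q = two_charts (d_zbar F0) (\<lambda>w. - d_zbar G w)"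
  have cF0: "continuous_on UNIV F0" and cG: "continuous_on UNIV G"
    using F0 G by (auto intro: smooth_continuous_on)
  show ?thesis unfolding q_def[symmetric]
  proof (rule integral_d_zbar_zero[of F p])
    show "integrable lborel q"
      unfolding q_def using F0 G
      by (intro integrable_two_charts smooth_continuous_on smooth_intros)
    show "integrable lborel p"
      unfolding p_def
    proof (rule integrable_split_disc)
      show "continuous_on UNIV (d_z F0)" by (rule smooth_continuous_on[OF smooth_d_z[OF F0]])
      show "continuous_on UNIV (\<lambda>w. - 2 * G w - w * d_z G w)"
        by (intro continuous_intros smooth_continuous_on[OF G] smooth_continuous_on[OF smooth_d_z[OF G]])
    qed (simp_all add: norm_divide norm_power)
    show "has_wirtinger F (p z) (q z) z" if "cmod z \<noteq> 1" for z
    proof (cases "cmod z < 1")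
      case True
      have "has_wirtinger F (d_z F0 z) (d_zbar F0 z) z"
        by (rule has_wirtinger_cong[OF smooth_has_wirtinger[OF F0], of "ball 0 1"])
          (use True in \<open>auto simp: F_def\<close>)
      thus ?thesis using True by (simp add: p_def q_def two_charts_def)
    next
      case False
      hence z: "cmod z > 1" "z \<noteq> 0" using that by auto
      have W1: "has_wirtinger (\<lambda>z. 1 / z) (- 1 / z\<^sup>2) 0 z"
        using has_wirtinger_inversion[OF has_wirtinger_id z(2)] by simp
      have W: "has_wirtinger (\<lambda>z. 1 / z\<^sup>2) ((1 / z) * (- 1 / z\<^sup>2) + (- 1 / z\<^sup>2) * (1 / z)) 0 z"
        using has_wirtinger_mult[OF W1 W1] by (simp add: power2_eq_square)
      have "has_wirtinger (\<lambda>z. G (1 / z) * (1 / z\<^sup>2))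
          (G (1 / z) * ((1 / z) * (- 1 / z\<^sup>2) + (- 1 / z\<^sup>2) * (1 / z))
            + (- d_z G (1 / z) / z\<^sup>2) * (1 / z\<^sup>2))
          (G (1 / z) * 0 + (- d_zbar G (1 / z) / (cnj z)\<^sup>2) * (1 / z\<^sup>2)) z"
        by (rule has_wirtinger_mult[OF has_wirtinger_inversion[OF smooth_has_wirtinger[OF G] z(2)] W])
      also have "G (1 / z) * ((1 / z) * (- 1 / z\<^sup>2) + (- 1 / z\<^sup>2) * (1 / z))
            + (- d_z G (1 / z) / z\<^sup>2) * (1 / z\<^sup>2) = p z"
      proof -
        have "g * (w * (- w\<^sup>2) + (- w\<^sup>2) * w) + (- d * w\<^sup>2) * w\<^sup>2 = w ^ 3 * (- 2 * g - w * d)"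
          for g w d :: complex
          by (simp add: algebra_simps power2_eq_square power3_eq_cube)
        from this[of "G (1 / z)" "1 / z" "d_z G (1 / z)"] show ?thesis
          using False by (simp add: p_def power_one_over)
      qed
      also have "G (1 / z) * 0 + (- d_zbar G (1 / z) / (cnj z)\<^sup>2) * (1 / z\<^sup>2) = q z"
      proof -
        have "complex_of_real (cmod z ^ 4) = (z * cnj z)\<^sup>2"
          unfolding complex_norm_square[symmetric] by simp
        thus ?thesis using z by (simp add: q_def two_charts_def power_mult_distrib mult.commute)
      qed
      finally show ?thesis
        by (rule has_wirtinger_cong[where S = "- cball 0 1"]) (use z in \<open>auto simp: F_def\<close>)
    qed
    show "continuous_on UNIV F"
    proof -
      have "continuous_on (cball 0 1 \<union> - ball 0 1) F"
        unfolding F_def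
      proof (rule continuous_on_If)
        show "continuous_on (cball 0 1) F0" by (rule continuous_on_subset[OF cF0]) simp
        show "continuous_on (- ball 0 1) (\<lambda>z. G (1 / z) / z\<^sup>2)"
          by (intro continuous_intros continuous_on_compose2[OF cG]) auto
        show "F0 z = G (1 / z) / z\<^sup>2" if "z \<in> cball 0 1" "\<not> cmod z < 1" for z
          using that by (intro match) auto
        show "F0 z = G (1 / z) / z\<^sup>2" if "z \<in> - ball 0 1" "cmod z < 1" for z
          using that by auto
      qed auto
      moreover have "cball 0 1 \<union> - ball 0 1 = (UNIV :: complex set)" by auto
      ultimately show ?thesis by simp
    qed
    show "(F \<longlongrightarrow> 0) at_infinity"
    proof -
      have "(\<lambda>z::complex. 1 / z) = inverse" by (simp add: fun_eq_iff inverse_eq_divide)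
      hence inv: "((\<lambda>z::complex. 1 / z) \<longlongrightarrow> 0) at_infinity"
        using tendsto_inverse_0[where 'a = complex] by metis
      have "isCont G 0" using cG by (simp add: continuous_on_eq_continuous_at)
      hence "((\<lambda>z. G (1 / z)) \<longlongrightarrow> G 0) at_infinity"
        using inv by (rule isCont_tendsto_compose)
      hence "((\<lambda>z. G (1 / z) * (1 / z)\<^sup>2) \<longlongrightarrow> G 0 * 0\<^sup>2) at_infinity"
        by (intro tendsto_intros inv)
      moreover have "\<forall>\<^sub>F z in at_infinity. G (1 / z) * (1 / z)\<^sup>2 = F z"
        unfolding eventually_at_infinity by (rule exI[of _ 1]) (auto simp: F_def power_divide)
      ultimately have "(F \<longlongrightarrow> G 0 * 0\<^sup>2) at_infinity" by (rule Lim_transform_eventually)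
      thus ?thesis by simp
    qed
  qed
qed

section \<open>Green's formula for sections glued along the equator\<close>

definition glue :: "nat \<Rightarrow> (complex \<Rightarrow> complex) \<Rightarrow> (complex \<Rightarrow> complex) \<Rightarrow> complex \<Rightarrow> complex" where
  "glue m A B z = (if cmod z < 1 then A z else z ^ m * B (1 / z))"

text \<open>
  Continuity of the section and of its \<open>\<partial>/\<partial>zbar\<close>-derivative across the equator: the latter is
  \<open>- z^m zbar^-2 (\<partial>B/\<partial>wbar)(1/z)\<close> on the outer side, and \<open>1/zbar = z\<close> on the unit circle.
\<close>

definition matched :: "nat \<Rightarrow> (complex \<Rightarrow> complex) \<Rightarrow> (complex \<Rightarrow> complex) \<Rightarrow> bool" where
  "matched m A B \<longleftrightarrow> smooth A \<and> smooth B \<and>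
     (\<forall>z. cmod z = 1 \<longrightarrow> A z = z ^ m * B (1 / z) \<and>
        d_zbar A z = - (z ^ (m + 2)) * d_zbar B (1 / z))"

definition ddbar :: "(complex \<Rightarrow> complex) \<Rightarrow> complex \<Rightarrow> complex" where
  "ddbar f = d_z (d_zbar f)"

lemma smooth_ddbar: "smooth f \<Longrightarrow> smooth (ddbar f)"
  unfolding ddbar_def by (intro smooth_intros)

lemma two_charts_add:
  "two_charts (\<lambda>z. U z + U' z) (\<lambda>z. V z + V' z) z = two_charts U V z + two_charts U' V' z"
  by (simp add: two_charts_def add_divide_distrib)

lemma two_charts_cnj:
  "two_charts (\<lambda>z. cnj (U z)) (\<lambda>z. cnj (V z)) z = cnj (two_charts U V z)"
  by (simp add: two_charts_def)

lemma two_charts_cmult: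
  "two_charts (\<lambda>z. c * U z) (\<lambda>z. c * V z) z = c * two_charts U V z"
  by (simp add: two_charts_def)

text \<open>
  Stokes' theorem for the form \<open>\<phi> h_m conj(\<partial>bar \<xi>)\<close>. It has type \<open>(1,0)\<close>, its coefficients are
  \<open>A conj(\<partial>bar s)\<close> and \<open>B conj(\<partial>bar t)\<close> in the two charts, and it is continuous because both
  factors are.
\<close>

lemma green_first_identity:
  assumes AB: "matched m A B" and st: "matched m s t"
  shows "integral\<^sup>L lborel (two_charts (\<lambda>z. A z * cnj (ddbar s z)) (\<lambda>z. B z * cnj (ddbar t z)))
    = - integral\<^sup>L lborel (two_charts (\<lambda>z. d_zbar A z * cnj (d_zbar s z)) (\<lambda>z. d_zbar B z * cnj (d_zbar t z)))"
proof -
  have sm: "smooth A" "smooth B" "smooth s" "smooth t" using AB st by (simp_all add: matched_def)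
  have prod: "d_zbar (\<lambda>z. f z * cnj (d_zbar g z)) = (\<lambda>z. f z * cnj (ddbar g z) + d_zbar f z * cnj (d_zbar g z))"
    if "smooth f" "smooth g" for f g
    unfolding ddbar_def
    by (intro ext has_wirtinger_imp(3)[OF has_wirtinger_mult[OF smooth_has_wirtinger[OF that(1)]
        has_wirtinger_cnj[OF smooth_has_wirtinger[OF smooth_d_zbar[OF that(2)]]]]])
  let ?F0 = "\<lambda>z. A z * cnj (d_zbar s z)" and ?G = "\<lambda>z. - (B z * cnj (d_zbar t z))"
  have "integral\<^sup>L lborel (two_charts (d_zbar ?F0) (\<lambda>w. - d_zbar ?G w)) = 0"
  proof (rule stokes_sphere)
    show "smooth ?F0" "smooth ?G" by (intro smooth_intros sm)+
    fix z :: complex assume z: "cmod z = 1"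
    hence z0: "z \<noteq> 0" and zc: "z * cnj z = 1" by (auto simp flip: complex_norm_square)
    have "A z * cnj (d_zbar s z) = - ((z * cnj z) ^ m * (cnj z)\<^sup>2 * (B (1 / z) * cnj (d_zbar t (1 / z))))"
      using AB st z by (simp add: matched_def power_add power_mult_distrib power2_eq_square mult_ac)
    also have "(cnj z)\<^sup>2 = 1 / z\<^sup>2"
      using z0 zc by (simp add: field_simps flip: power_mult_distrib)
    finally show "A z * cnj (d_zbar s z) = - (B (1 / z) * cnj (d_zbar t (1 / z))) / z\<^sup>2"
      by (simp add: zc)
  qed
  also have "d_zbar ?F0 = (\<lambda>z. A z * cnj (ddbar s z) + d_zbar A z * cnj (d_zbar s z))"
    by (rule prod[OF sm(1,3)])
  also have "(\<lambda>w. - d_zbar ?G w) = (\<lambda>z. B z * cnj (ddbar t z) + d_zbar B z * cnj (d_zbar t z))"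
  proof (rule ext)
    fix z
    have "smooth (\<lambda>z. B z * cnj (d_zbar t z))" by (intro smooth_intros sm)
    from has_wirtinger_minus[OF smooth_has_wirtinger[OF this, of z]]
    show "- d_zbar ?G z = B z * cnj (ddbar t z) + d_zbar B z * cnj (d_zbar t z)"
      by (simp only: has_wirtinger_imp(3) prod[OF sm(2,4)] minus_minus)
  qed
  finally have "(LINT z|lborel. two_charts (\<lambda>z. A z * cnj (ddbar s z)) (\<lambda>z. B z * cnj (ddbar t z)) z
      + two_charts (\<lambda>z. d_zbar A z * cnj (d_zbar s z)) (\<lambda>z. d_zbar B z * cnj (d_zbar t z)) z) = 0"
    by (simp only: two_charts_add[abs_def])
  moreover have "integrable lborel (two_charts (\<lambda>z. A z * cnj (ddbar s z)) (\<lambda>z. B z * cnj (ddbar t z)))"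
    "integrable lborel (two_charts (\<lambda>z. d_zbar A z * cnj (d_zbar s z)) (\<lambda>z. d_zbar B z * cnj (d_zbar t z)))"
    by (intro integrable_two_charts smooth_continuous_on smooth_intros smooth_ddbar sm)+
  ultimately show ?thesis by (simp add: eq_neg_iff_add_eq_0)
qed

text \<open>
  Both sides are minus the Dirichlet pairing of the two sections, which is Hermitian.
\<close>

lemma green_formula:
  assumes AB: "matched m A B" and st: "matched m s t"
  shows "integral\<^sup>L lborel (two_charts (\<lambda>z. A z * cnj (ddbar s z)) (\<lambda>z. B z * cnj (ddbar t z)))
    = integral\<^sup>L lborel (two_charts (\<lambda>z. ddbar A z * cnj (s z)) (\<lambda>z. ddbar B z * cnj (t z)))"
proof -
  have "integral\<^sup>L lborel (two_charts (\<lambda>z. ddbar A z * cnj (s z)) (\<lambda>z. ddbar B z * cnj (t z)))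
     = (LINT z|lborel. cnj (two_charts (\<lambda>z. s z * cnj (ddbar A z)) (\<lambda>z. t z * cnj (ddbar B z)) z))"
    by (simp add: two_charts_cnj[symmetric] mult.commute)
  also have "\<dots> = cnj (- integral\<^sup>L lborel (two_charts (\<lambda>z. d_zbar s z * cnj (d_zbar A z)) (\<lambda>z. d_zbar t z * cnj (d_zbar B z))))"
    by (simp add: green_first_identity[OF st AB])
  also have "\<dots> = - (LINT z|lborel. cnj (two_charts (\<lambda>z. d_zbar s z * cnj (d_zbar A z)) (\<lambda>z. d_zbar t z * cnj (d_zbar B z)) z))"
    by simp
  also have "\<dots> = - integral\<^sup>L lborel (two_charts (\<lambda>z. d_zbar A z * cnj (d_zbar s z)) (\<lambda>z. d_zbar B z * cnj (d_zbar t z)))"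
    by (simp add: two_charts_cnj[symmetric] mult.commute)
  finally show ?thesis by (simp add: green_first_identity[OF AB st])
qed

section \<open>Sections and the Laplacian in the two charts\<close>

lemma has_wirtinger_frame_change:
  assumes "smooth t" "z \<noteq> 0"
  shows "\<exists>p. has_wirtinger (\<lambda>z. z ^ m * t (1 / z)) p (- (z ^ m) * d_zbar t (1 / z) / (cnj z)\<^sup>2) z"
  using has_wirtinger_mult[OF has_wirtinger_power has_wirtinger_inversion[OF smooth_has_wirtinger[OF assms(1)] assms(2)]]
  by auto

lemma smooth_sections_charts:
  assumes "smooth s" "smooth t" "\<And>w. w \<noteq> 0 \<Longrightarrow> t w = w ^ m * s (1 / w)"
  shows "z \<noteq> 0 \<Longrightarrow> s z = z ^ m * t (1 / z)"
    "z \<noteq> 0 \<Longrightarrow> d_zbar s z = - (z ^ m) * d_zbar t (1 / z) / (cnj z)\<^sup>2"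
    "s = glue m s t" "matched m s t"
proof -
  show eq: "s z = z ^ m * t (1 / z)" if "z \<noteq> 0" for z
    using assms(3)[of "1 / z"] that by (simp add: power_divide)
  show d: "d_zbar s z = - (z ^ m) * d_zbar t (1 / z) / (cnj z)\<^sup>2" if z: "z \<noteq> 0" for z
  proof -
    obtain p where "has_wirtinger (\<lambda>z. z ^ m * t (1 / z)) p (- (z ^ m) * d_zbar t (1 / z) / (cnj z)\<^sup>2) z"
      using has_wirtinger_frame_change[OF assms(2) z] by blast
    hence "has_wirtinger s p (- (z ^ m) * d_zbar t (1 / z) / (cnj z)\<^sup>2) z"
      by (rule has_wirtinger_cong[where S = "- {0}"]) (use z eq in auto)
    thus ?thesis by (rule has_wirtinger_imp(3))
  qed
  show "s = glue m s t"
  proof (rule ext)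
    fix z show "s z = glue m s t z" using eq[of z] by (cases "z = 0") (simp_all add: glue_def)
  qed
  show "matched m s t"
    unfolding matched_def
  proof (intro conjI allI impI assms)
    fix z :: complex assume z: "cmod z = 1"
    hence z0: "z \<noteq> 0" and zc: "z * cnj z = 1" by (auto simp flip: complex_norm_square)
    show "s z = z ^ m * t (1 / z)" by (rule eq[OF z0])
    have "(cnj z)\<^sup>2 = 1 / z\<^sup>2"
      using z0 zc by (simp add: field_simps flip: power_mult_distrib)
    thus "d_zbar s z = - (z ^ (m + 2)) * d_zbar t (1 / z)"
      unfolding d[OF z0] by (simp add: power_add power2_eq_square)
  qed
qed

lemma smooth_sections_obtain:
  assumes "\<xi> \<in> smooth_sections m"
  obtains t where "smooth \<xi>" "smooth t" "\<And>w. w \<noteq> 0 \<Longrightarrow> t w = w ^ m * \<xi> (1 / w)"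
  using assms by (auto simp: smooth_sections_def)

lemma ddbar_cong:
  assumes "open S" "z \<in> S" "\<And>u. u \<in> S \<Longrightarrow> f u = g u" "smooth f" "smooth g"
  shows "ddbar f z = ddbar g z"
proof -
  have eq: "d_zbar f u = d_zbar g u" if "u \<in> S" for u
    using has_wirtinger_imp(3)[OF has_wirtinger_cong[OF smooth_has_wirtinger[OF assms(4)] assms(1) that assms(3)]]
    by simp
  show ?thesis unfolding ddbar_def
    using has_wirtinger_imp(2)[OF has_wirtinger_cong[OF smooth_has_wirtinger[OF smooth_d_zbar[OF assms(4)]] assms(1,2) eq]]
    by simp
qed

lemma d_zbar_sum:
  assumes "\<And>k. k \<in> I \<Longrightarrow> smooth (g k)"
  shows "d_zbar (\<lambda>z. \<Sum>k\<in>I. g k z) = (\<lambda>z. \<Sum>k\<in>I. d_zbar (g k) z)"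
  using has_wirtinger_sum[of I g "\<lambda>k. d_z (g k) _" "\<lambda>k. d_zbar (g k) _"] assms
  by (intro ext has_wirtinger_imp(3)) (blast intro: smooth_has_wirtinger)

lemma ddbar_sum:
  assumes "\<And>k. k \<in> I \<Longrightarrow> smooth (g k)"
  shows "ddbar (\<lambda>z. \<Sum>k\<in>I. g k z) z = (\<Sum>k\<in>I. ddbar (g k) z)"
proof -
  have "d_zbar (\<lambda>z. \<Sum>k\<in>I. g k z) = (\<lambda>z. \<Sum>k\<in>I. d_zbar (g k) z)"
    using assms by (rule d_zbar_sum)
  thus ?thesis
    unfolding ddbar_def
    by (simp only:) (rule has_wirtinger_imp(2)[OF has_wirtinger_sum[OF smooth_has_wirtinger]],
      intro smooth_d_zbar assms)
qed

lemma d_zbar_power_mult: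
  assumes "smooth f"
  shows "d_zbar (\<lambda>u. u ^ k * f u) z = z ^ k * d_zbar f z"
  using has_wirtinger_imp(3)[OF has_wirtinger_mult[OF has_wirtinger_power smooth_has_wirtinger[OF assms]]]
  by simp

text \<open>
  Splitting off the antiholomorphic factor of \<open>h_m(z^k, z^k)\<close>, which \<open>\<partial>/\<partial>z\<close> does not see.
\<close>

lemma d_z_antiholomorphic_mult:
  assumes "has_wirtinger f p q z" "has_wirtinger g p' q' z" "\<And>u. u \<in> S \<Longrightarrow> F u = cnj (f u) * g u" "q = 0"
    "open S" "z \<in> S"
  shows "d_z F z = cnj (f z) * p'"
  using has_wirtinger_imp(2)[OF has_wirtinger_cong[OF has_wirtinger_mult[OF has_wirtinger_cnj[OF assms(1)] assms(2)]
      assms(5,6) assms(3)[symmetric]]] assms(4) by simp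

lemma laplacian_tensor_inner:
  assumes "smooth f" "0 < cmod z" "cmod z < 1"
  shows "laplacian_tensor m f k z = - ddbar (\<lambda>z. f z * z ^ k) z"
proof -
  let ?g = "\<lambda>u. u ^ k * f u"
  have sg: "smooth ?g" by (intro smooth_intros assms)
  have z0: "z \<noteq> 0" using assms by auto
  have h: "h_metric m u (u ^ k) (u ^ k) = cnj (u ^ k) * u ^ k" if "u \<in> ball 0 1" for u
    using that by (simp add: h_metric_def max_def)
  have zm: "z \<in> ball 0 1" using assms by simp
  have "d_z (\<lambda>u. h_metric m u (u ^ k) (u ^ k) * d_zbar f u) z = cnj (z ^ k) * ddbar ?g z"
    unfolding ddbar_def
    by (rule d_z_antiholomorphic_mult[OF has_wirtinger_power smooth_has_wirtinger[OF smooth_d_zbar[OF sg]] _ refl open_ball zm])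
      (simp add: h d_zbar_power_mult[OF assms(1)])
  thus ?thesis
    using z0 assms h[OF zm] by (simp add: laplacian_tensor_def tensor_z_def h_T_def max_def mult.commute)
qed

lemma laplacian_tensor_outer:
  assumes f: "smooth f" and t: "smooth t" and ft: "\<And>w. w \<noteq> 0 \<Longrightarrow> t w = f (1 / w)"
    and z: "cmod z > 1" and k: "k \<le> m"
  shows "laplacian_tensor m f k z = - (z ^ m) * ddbar (\<lambda>w. w ^ (m - k) * t w) (1 / z)"
proof -
  let ?g = "\<lambda>w. w ^ (m - k) * t w"
  have sg: "smooth ?g" by (intro smooth_intros t)
  have z0: "z \<noteq> 0" using z by auto
  have zm: "z \<in> - cball 0 1" using z by simp
  have nz: "of_real (cmod u ^ (2 * j)) = u ^ j * cnj u ^ j" for u j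
  proof -
    have "of_real (cmod u ^ (2 * j)) = complex_of_real ((cmod u)\<^sup>2) ^ j" by (simp add: power_mult)
    thus ?thesis by (simp only: complex_norm_square power_mult_distrib)
  qed
  have h: "h_metric m u (u ^ k) (u ^ k) = cnj ((1 / u) ^ (m - k)) * (1 / u) ^ (m - k)"
    if "u \<in> - cball 0 1" for u
  proof -
    have u: "u \<noteq> 0" "max 1 (cmod u) = cmod u" using that by auto
    have "u ^ m = u ^ k * u ^ (m - k)" using k by (simp flip: power_add)
    moreover from this have "cnj u ^ m = cnj u ^ k * cnj u ^ (m - k)"
      by (simp flip: complex_cnj_power complex_cnj_mult)
    ultimately show ?thesis
      unfolding h_metric_def u(2) nz[of u m] using u(1) by (simp add: power_one_over divide_simps)
  qed
  have df: "d_zbar f u = - d_zbar t (1 / u) / (cnj u)\<^sup>2" if "u \<noteq> 0" for u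
    using smooth_sections_charts(2)[OF f t, of 0 u] ft that by simp
  have P: "has_wirtinger (\<lambda>u. (1 / u) ^ (m - k) * (1 / u)\<^sup>2)
      ((1 / z) ^ (m - k) * (2 * (1 / z) * (- 1 / z\<^sup>2)) + of_nat (m - k) * (1 / z) ^ (m - k - 1) * (- 1 / z\<^sup>2) * (1 / z)\<^sup>2) 0 z"
  proof -
    have "has_wirtinger (\<lambda>u. (1 / u) ^ j) (of_nat j * (1 / z) ^ (j - 1) * (- 1 / z\<^sup>2)) 0 z" for j
      using has_wirtinger_inversion[OF has_wirtinger_power[of j] z0] by simp
    from has_wirtinger_mult[OF this[of "m - k"] this[of 2]] show ?thesis by simp
  qed
  have G: "has_wirtinger (\<lambda>u. - d_zbar ?g (1 / u)) (ddbar ?g (1 / z) / z\<^sup>2)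
      (- (- d_zbar (d_zbar ?g) (1 / z) / (cnj z)\<^sup>2)) z"
    using has_wirtinger_minus[OF has_wirtinger_inversion[OF smooth_has_wirtinger[OF smooth_d_zbar[OF sg]] z0]]
    by (simp add: ddbar_def)
  have "d_z (\<lambda>u. h_metric m u (u ^ k) (u ^ k) * d_zbar f u) z
      = cnj ((1 / z) ^ (m - k) * (1 / z)\<^sup>2) * (ddbar ?g (1 / z) / z\<^sup>2)"
  proof (rule d_z_antiholomorphic_mult[OF P G _ refl _ zm])
    fix u assume u: "u \<in> - cball (0::complex) 1"
    hence "u \<noteq> 0" by auto
    thus "h_metric m u (u ^ k) (u ^ k) * d_zbar f u
        = cnj ((1 / u) ^ (m - k) * (1 / u)\<^sup>2) * (- d_zbar ?g (1 / u))"
      by (simp add: h[OF u] df d_zbar_power_mult[OF t] power_one_over)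
  qed auto
  hence D: "d_z (\<lambda>u. h_metric m u (u ^ k) (u ^ k) * d_zbar f u) z
      = 1 / (cnj z ^ (m - k) * (cnj z)\<^sup>2) * (ddbar ?g (1 / z) / z\<^sup>2)"
    by (simp add: power_one_over)
  have T: "inverse (of_real (h_T z)) = (z * cnj z)\<^sup>2"
    using z nz[of z 2] by (simp add: h_T_def max_def power_mult_distrib)
  have H: "h_metric m z (z ^ k) (z ^ k) = 1 / (cnj z ^ (m - k) * z ^ (m - k))"
    using h[OF zm] by (simp add: power_one_over)
  have zpow: "z ^ m = z ^ k * z ^ (m - k)" using k by (simp flip: power_add)
  have alg: "(x * c)\<^sup>2 * inverse (1 / (Y * X)) * (1 / (Y * c\<^sup>2) * (e / x\<^sup>2)) * K = K * X * e"
    if "x \<noteq> 0" "c \<noteq> 0" "X \<noteq> 0" "Y \<noteq> 0" for x c X Y e K :: complex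
    using that by (simp add: power_mult_distrib)
  have "laplacian_tensor m f k z = - ((z * cnj z)\<^sup>2 * inverse (1 / (cnj z ^ (m - k) * z ^ (m - k)))
      * (1 / (cnj z ^ (m - k) * (cnj z)\<^sup>2) * (ddbar ?g (1 / z) / z\<^sup>2))) * z ^ k"
    using z by (simp add: laplacian_tensor_def tensor_z_def D T H)
  also have "\<dots> = - (z ^ m) * ddbar ?g (1 / z)"
    using alg[of z "cnj z" "z ^ (m - k)" "cnj z ^ (m - k)" "ddbar ?g (1 / z)" "z ^ k"] z0
    by (simp add: zpow)
  finally show ?thesis .
qed

lemma one_plus_norm_nonzero: "1 + z * cnj z \<noteq> 0"
proof
  assume "1 + z * cnj z = 0"
  hence "Re (1 + z * cnj z) = 0" by simp
  hence "1 + ((Re z)\<^sup>2 + (Im z)\<^sup>2) = 0" by (simp add: power2_eq_square)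
  thus False by (smt (verit) zero_le_power2)
qed

text \<open>
  A decomposition comes from \<open>1 = (1 + |z|^2)^m / (1 + |z|^2)^m\<close> and the binomial theorem.
\<close>

lemma decomposes_exists:
  assumes "\<xi> \<in> smooth_sections m"
  shows "\<exists>f. decomposes m \<xi> f"
proof -
  obtain t where s: "smooth \<xi>" and t: "smooth t" and st: "\<And>w. w \<noteq> 0 \<Longrightarrow> t w = w ^ m * \<xi> (1 / w)"
    using smooth_sections_obtain[OF assms] by blast
  note nz = one_plus_norm_nonzero
  define f where "f = (\<lambda>k z. of_nat (m choose k) * \<xi> z * cnj z ^ k / (1 + z * cnj z) ^ m)"
  have "f k \<in> smooth_sections 0" if "k \<le> m" for k
  proof -
    let ?t = "\<lambda>w. of_nat (m choose k) * t w * cnj w ^ (m - k) / (1 + w * cnj w) ^ m"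
    have "smooth (f k)" "smooth ?t"
      unfolding f_def by (intro smooth_intros s t; use nz in simp)+
    moreover have "?t w = w ^ 0 * f k (1 / w)" if w: "w \<noteq> 0" for w
    proof -
      have "1 + 1 / w * cnj (1 / w) = (1 + w * cnj w) / (w * cnj w)"
        using w by (simp add: field_simps)
      moreover have "cnj w ^ m = cnj w ^ (m - k) * cnj w ^ k"
        using \<open>k \<le> m\<close> by (simp flip: power_add)
      ultimately show ?thesis
        using w nz[of w] by (simp add: f_def st power_divide power_mult_distrib)
    qed
    ultimately show ?thesis unfolding smooth_sections_def by blast
  qed
  moreover have "\<xi> z = (\<Sum>k\<le>m. (f k \<otimes>z k) z)" for z
  proof -
    have "(\<Sum>k\<le>m. (f k \<otimes>z k) z) = \<xi> z / (1 + z * cnj z) ^ m * (\<Sum>k\<le>m. of_nat (m choose k) * (z * cnj z) ^ k * 1 ^ (m - k))"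
      by (simp add: f_def tensor_z_def sum_distrib_left power_mult_distrib mult_ac)
    also have "\<dots> = \<xi> z / (1 + z * cnj z) ^ m * (z * cnj z + 1) ^ m" by (simp only: binomial_ring)
    finally show ?thesis using nz[of z] by (simp add: add.commute)
  qed
  ultimately show ?thesis unfolding decomposes_def by blast
qed

text \<open>
  The result does not involve the decomposition: in the chart frames the weight \<open>h_m(z^k, z^k)\<close> is a
  holomorphic times an antiholomorphic function, so that every tensor contributes
  \<open>- \<partial>\<partial>bar\<close> of its coefficient.
\<close>

lemma laplacian_charts:
  assumes s: "smooth \<xi>" and t: "smooth t" and st: "\<And>w. w \<noteq> 0 \<Longrightarrow> t w = w ^ m * \<xi> (1 / w)"
  shows "0 < cmod z \<Longrightarrow> cmod z < 1 \<Longrightarrow> laplacian m \<xi> z = - ddbar \<xi> z"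
    "cmod z > 1 \<Longrightarrow> laplacian m \<xi> z = - (z ^ m) * ddbar t (1 / z)"
    "cmod z = 1 \<Longrightarrow> laplacian m \<xi> z = 0"
proof -
  have "\<xi> \<in> smooth_sections m" using assms by (auto simp: smooth_sections_def)
  define f where "f = (SOME f. decomposes m \<xi> f)"
  have "decomposes m \<xi> f"
    unfolding f_def using decomposes_exists[OF \<open>\<xi> \<in> smooth_sections m\<close>] by (rule someI_ex)
  hence f: "\<And>k. k \<le> m \<Longrightarrow> f k \<in> smooth_sections 0" and \<xi>: "\<xi> = (\<lambda>z. \<Sum>k\<le>m. (f k \<otimes>z k) z)"
    by (simp_all add: decomposes_def)
  have L: "laplacian m \<xi> z = (\<Sum>k\<le>m. laplacian_tensor m (f k) k z)" for z
    by (simp add: laplacian_def f_def)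
  have sf: "smooth (f k)" if "k \<le> m" for k using f[OF that] by (simp add: smooth_sections_def)
  obtain g where g: "\<And>k. k \<le> m \<Longrightarrow> smooth (g k)" "\<And>k w. k \<le> m \<Longrightarrow> w \<noteq> 0 \<Longrightarrow> g k w = f k (1 / w)"
  proof -
    have "\<forall>k. \<exists>g. k \<le> m \<longrightarrow> smooth g \<and> (\<forall>w. w \<noteq> 0 \<longrightarrow> g w = f k (1 / w))"
      using f by (fastforce simp: smooth_sections_def)
    then obtain g where "\<forall>k. k \<le> m \<longrightarrow> smooth (g k) \<and> (\<forall>w. w \<noteq> 0 \<longrightarrow> g k w = f k (1 / w))"
      using choice[of "\<lambda>k g. k \<le> m \<longrightarrow> smooth g \<and> (\<forall>w. w \<noteq> 0 \<longrightarrow> g w = f k (1 / w))"] by blast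
    thus ?thesis using that by blast
  qed
  show "laplacian m \<xi> z = - ddbar \<xi> z" if "0 < cmod z" "cmod z < 1"
  proof -
    have "laplacian m \<xi> z = (\<Sum>k\<le>m. - ddbar (\<lambda>z. f k z * z ^ k) z)"
      unfolding L by (intro sum.cong refl laplacian_tensor_inner that sf) auto
    also have "\<dots> = - ddbar (\<lambda>z. \<Sum>k\<le>m. f k z * z ^ k) z"
      by (subst ddbar_sum) (auto simp: sum_negf intro!: smooth_mult smooth_power smooth_id sf)
    also have "(\<lambda>z. \<Sum>k\<le>m. f k z * z ^ k) = \<xi>" by (subst \<xi>) (simp add: tensor_z_def)
    finally show ?thesis .
  qed
  show "laplacian m \<xi> z = - (z ^ m) * ddbar t (1 / z)" if z: "cmod z > 1"
  proof -
    have "z \<noteq> 0" using z by auto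
    have "laplacian m \<xi> z = (\<Sum>k\<le>m. - (z ^ m) * ddbar (\<lambda>w. w ^ (m - k) * g k w) (1 / z))"
      unfolding L by (intro sum.cong refl laplacian_tensor_outer z sf g) auto
    also have "\<dots> = - (z ^ m) * ddbar (\<lambda>w. \<Sum>k\<le>m. w ^ (m - k) * g k w) (1 / z)"
      by (subst ddbar_sum) (auto simp: sum_distrib_left intro!: smooth_mult smooth_power smooth_id g)
    also have "ddbar (\<lambda>w. \<Sum>k\<le>m. w ^ (m - k) * g k w) (1 / z) = ddbar t (1 / z)"
    proof (rule ddbar_cong[of "- {0}"])
      fix w :: complex assume w: "w \<in> - {0}"
      have "t w = (\<Sum>k\<le>m. w ^ m * (f k (1 / w) * (1 / w) ^ k))"
        using st[of w] w fun_cong[OF \<xi>, of "1 / w"] by (simp add: tensor_z_def sum_distrib_left)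
      also have "\<dots> = (\<Sum>k\<le>m. w ^ (m - k) * g k w)"
        using w by (intro sum.cong) (auto simp: g power_diff power_one_over field_simps)
      finally show "(\<Sum>k\<le>m. w ^ (m - k) * g k w) = t w" by simp
    qed (use \<open>z \<noteq> 0\<close> in \<open>auto intro!: smooth_sum smooth_mult smooth_power smooth_id g t\<close>)
    finally show ?thesis .
  qed
  show "laplacian m \<xi> z = 0" if "cmod z = 1"
    unfolding L using that by (simp add: laplacian_tensor_def tensor_z_def)
qed

section \<open>Weak eigensections\<close>

lemma borel_measurable_cnj [measurable]:
  "f \<in> borel_measurable M \<Longrightarrow> (\<lambda>x. cnj (f x)) \<in> borel_measurable M"
  by (rule measurable_compose[of f M borel]) (auto intro!: borel_measurable_continuous_onI continuous_intros)

lemma borel_measurable_complex_of_real [measurable]: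
  "f \<in> borel_measurable M \<Longrightarrow> (\<lambda>x. complex_of_real (f x)) \<in> borel_measurable M"
  by (rule measurable_compose[of f M borel]) (auto intro!: borel_measurable_continuous_onI continuous_intros)

lemma glue_borel:
  assumes "continuous_on UNIV A" "continuous_on UNIV B"
  shows "glue m A B \<in> borel_measurable borel"
proof -
  have [measurable]: "A \<in> borel_measurable borel" "B \<in> borel_measurable borel"
    using assms by (simp_all only: borel_measurable_continuous_onI)
  show ?thesis unfolding glue_def[abs_def] by measurable
qed

lemma AE_off_equator: "AE z in lborel. z \<noteq> 0 \<and> cmod z \<noteq> 1"
proof (rule AE_I')
  have "sphere (0::complex) 1 \<in> null_sets lborel"
    using negligible_sphere[of "0::complex" 1]
    by (auto simp: null_sets_completion_iff negligible_iff_null_sets negligible_convex_frontier)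
  moreover have "{0::complex} \<in> null_sets lborel" by (rule finite_imp_null_set_lborel) simp
  ultimately show "{0} \<union> sphere (0::complex) 1 \<in> null_sets lborel" by (rule null_sets.Un[rotated])
qed auto

lemma L2_inner_lborel:
  assumes [measurable]: "\<phi> \<in> borel_measurable borel" "\<eta> \<in> borel_measurable borel"
  shows "L2_inner m \<phi> \<eta>
    = 1 / pi * (LINT z|lborel. \<phi> z * cnj (\<eta> z) / of_real (max 1 (cmod z) ^ (2 * m + 4)))"
proof -
  have "L2_inner m \<phi> \<eta> = (LINT z|lborel. (1 / (pi * max 1 (cmod z) ^ 4)) *\<^sub>R h_metric m z (\<phi> z) (\<eta> z))"
    unfolding L2_inner_def omega_inf_def
    by (subst integral_density) (auto simp: h_metric_def simp del: of_real_power)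
  also have "\<dots> = (LINT z|lborel. 1 / pi * (\<phi> z * cnj (\<eta> z) / of_real (max 1 (cmod z) ^ (2 * m + 4))))"
    by (intro Bochner_Integration.integral_cong refl)
      (simp add: h_metric_def scaleR_conv_of_real power_add)
  finally show ?thesis by (simp only: integral_mult_right_zero)
qed

lemma L2_inner_two_charts:
  assumes \<phi>: "\<phi> \<in> borel_measurable borel" and \<eta>: "\<eta> \<in> borel_measurable borel"
    and UV: "continuous_on UNIV U" "continuous_on UNIV V"
    and inner: "\<And>z. z \<noteq> 0 \<Longrightarrow> cmod z < 1 \<Longrightarrow> \<phi> z * cnj (\<eta> z) = U z"
    and outer: "\<And>z. cmod z > 1 \<Longrightarrow> \<phi> z * cnj (\<eta> z) = (z * cnj z) ^ m * V (1 / z)"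
  shows "L2_inner m \<phi> \<eta> = 1 / pi * integral\<^sup>L lborel (two_charts U V)"
proof -
  note [measurable] = \<phi> \<eta>
  have [measurable]: "two_charts U V \<in> borel_measurable borel"
    using borel_measurable_integrable[OF integrable_two_charts[OF UV]] by simp
  have "\<phi> z * cnj (\<eta> z) / of_real (max 1 (cmod z) ^ (2 * m + 4)) = two_charts U V z"
    if z: "z \<noteq> 0" "cmod z \<noteq> 1" for z
  proof (cases "cmod z < 1")
    case True
    thus ?thesis using inner[OF z(1)] by (simp add: two_charts_def max_def)
  next
    case False
    hence z1: "cmod z > 1" using z by simp
    have "complex_of_real (cmod z ^ (2 * m)) = complex_of_real ((cmod z)\<^sup>2) ^ m" by (simp add: power_mult)
    also have "\<dots> = (z * cnj z) ^ m" by (simp only: complex_norm_square)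
    finally have "complex_of_real (cmod z ^ (2 * m + 4)) = (z * cnj z) ^ m * of_real (cmod z ^ 4)"
      by (simp only: power_add of_real_mult)
    moreover have "max 1 (cmod z) = cmod z" using z1 by simp
    ultimately show ?thesis
      using z1 z(1) by (simp only: outer[OF z1] two_charts_def) simp
  qed
  hence "AE z in lborel. \<phi> z * cnj (\<eta> z) / of_real (max 1 (cmod z) ^ (2 * m + 4)) = two_charts U V z"
    using AE_off_equator by auto
  hence "(LINT z|lborel. \<phi> z * cnj (\<eta> z) / of_real (max 1 (cmod z) ^ (2 * m + 4)))
      = integral\<^sup>L lborel (two_charts U V)"
    by (intro integral_cong_AE) measurable
  thus ?thesis by (simp only: L2_inner_lborel[OF \<phi> \<eta>])
qed

lemma laplacian_borel:
  assumes s: "smooth \<xi>" and t: "smooth t" and st: "\<And>w. w \<noteq> 0 \<Longrightarrow> t w = w ^ m * \<xi> (1 / w)"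
  shows "laplacian m \<xi> \<in> borel_measurable borel"
proof -
  \<comment> \<open>At 0 the value depends on the decomposition that was chosen; a single point is harmless.\<close>
  define c where "c = laplacian m \<xi> 0"
  note L = laplacian_charts[OF s t st]
  have "laplacian m \<xi> = (\<lambda>z. if z = 0 then c else if cmod z < 1 then - ddbar \<xi> z
      else if cmod z = 1 then 0 else - (z ^ m) * ddbar t (1 / z))"
  proof (rule ext)
    fix z :: complex
    consider "z = 0" | "0 < cmod z" "cmod z < 1" | "cmod z = 1" | "cmod z > 1" by force
    thus "laplacian m \<xi> z = (if z = 0 then c else if cmod z < 1 then - ddbar \<xi> z
        else if cmod z = 1 then 0 else - (z ^ m) * ddbar t (1 / z))"
      by cases (auto simp: c_def L)
  qed
  moreover have "ddbar \<xi> \<in> borel_measurable borel" "ddbar t \<in> borel_measurable borel"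
    using s t by (simp_all only: smooth_borel smooth_ddbar)
  ultimately show ?thesis by simp
qed

text \<open>
  The matching conditions make the boundary terms on the equator cancel, so that a section that
  solves the eigenvalue equation on both discs does so weakly on the sphere.
\<close>

lemma weak_eigensection:
  assumes AB: "matched m A B"
    and A: "\<And>z. ddbar A z = - \<alpha> * A z" and B: "\<And>z. ddbar B z = - \<alpha> * B z"
    and \<xi>: "\<xi> \<in> smooth_sections m"
  shows "L2_inner m (glue m A B) (laplacian m \<xi>) = \<alpha> * L2_inner m (glue m A B) \<xi>"
proof -
  obtain t where s: "smooth \<xi>" and t: "smooth t" and st: "\<And>w. w \<noteq> 0 \<Longrightarrow> t w = w ^ m * \<xi> (1 / w)"
    using smooth_sections_obtain[OF \<xi>] by blast
  note L = laplacian_charts[OF s t st]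
  have st_matched: "matched m \<xi> t" by (rule smooth_sections_charts(4)[OF s t st])
  have sm: "smooth A" "smooth B" using AB by (simp_all add: matched_def)
  note gm = glue_borel[OF smooth_continuous_on[OF sm(1)] smooth_continuous_on[OF sm(2)]]
  have "L2_inner m (glue m A B) (laplacian m \<xi>)
      = 1 / pi * integral\<^sup>L lborel (two_charts (\<lambda>z. - 1 * (A z * cnj (ddbar \<xi> z))) (\<lambda>z. - 1 * (B z * cnj (ddbar t z))))"
  proof (rule L2_inner_two_charts[OF gm laplacian_borel[OF s t st]])
    show "glue m A B z * cnj (laplacian m \<xi> z) = - 1 * (A z * cnj (ddbar \<xi> z))" if "z \<noteq> 0" "cmod z < 1" for z
      using that by (simp add: L glue_def)
    show "glue m A B z * cnj (laplacian m \<xi> z) = (z * cnj z) ^ m * (- 1 * (B (1 / z) * cnj (ddbar t (1 / z))))"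
      if "1 < cmod z" for z
      using that by (simp add: L glue_def power_mult_distrib)
  qed (assumption | intro smooth_continuous_on smooth_intros smooth_ddbar sm s t)+
  also have "\<dots> = - 1 / pi * integral\<^sup>L lborel (two_charts (\<lambda>z. A z * cnj (ddbar \<xi> z)) (\<lambda>z. B z * cnj (ddbar t z)))"
    by (simp only: two_charts_cmult[abs_def]) simp
  also have "\<dots> = - 1 / pi * integral\<^sup>L lborel (two_charts (\<lambda>z. - \<alpha> * (A z * cnj (\<xi> z))) (\<lambda>z. - \<alpha> * (B z * cnj (t z))))"
    by (simp only: green_formula[OF AB st_matched] A B mult.assoc)
  also have "\<dots> = \<alpha> * (1 / pi * integral\<^sup>L lborel (two_charts (\<lambda>z. A z * cnj (\<xi> z)) (\<lambda>z. B z * cnj (t z))))"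
    by (simp only: two_charts_cmult[abs_def]) simp
  also have "1 / pi * integral\<^sup>L lborel (two_charts (\<lambda>z. A z * cnj (\<xi> z)) (\<lambda>z. B z * cnj (t z)))
      = L2_inner m (glue m A B) \<xi>"
  proof (rule L2_inner_two_charts[symmetric, OF gm smooth_borel[OF s]])
    show "glue m A B z * cnj (\<xi> z) = A z * cnj (\<xi> z)" if "z \<noteq> 0" "cmod z < 1" for z
      using that by (simp add: glue_def)
    show "glue m A B z * cnj (\<xi> z) = (z * cnj z) ^ m * (B (1 / z) * cnj (t (1 / z)))"
      if "1 < cmod z" for z
    proof -
      have "z \<noteq> 0" using that by auto
      have "\<xi> z = z ^ m * t (1 / z)" by (rule smooth_sections_charts(1)[OF s t st \<open>z \<noteq> 0\<close>])
      thus ?thesis using that by (simp add: glue_def power_mult_distrib)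
    qed
  qed (intro smooth_continuous_on smooth_intros sm s t)+
  finally show ?thesis .
qed

text \<open>A holomorphic section has \<open>\<partial>/\<partial>zbar = 0\<close> in both charts.\<close>

lemma matched_power:
  assumes "k \<le> m"
  shows "matched m (\<lambda>z. z ^ k) (\<lambda>w. w ^ (m - k))" "ddbar (\<lambda>z. z ^ k) z = 0"
    "glue m (\<lambda>z. z ^ k) (\<lambda>w. w ^ (m - k)) = (\<lambda>z. z ^ k)"
proof -
  have d: "d_zbar (\<lambda>z. z ^ j) = (\<lambda>z. 0)" for j
    by (rule ext) (rule has_wirtinger_imp(3)[OF has_wirtinger_power])
  have eq: "z ^ k = z ^ m * (1 / z) ^ (m - k)" if "z \<noteq> 0" for z :: complex
    using that assms by (simp add: power_one_over power_diff)
  show "matched m (\<lambda>z. z ^ k) (\<lambda>w. w ^ (m - k))"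
    unfolding matched_def d
  proof (intro conjI allI impI smooth_power smooth_id)
    fix z :: complex assume "cmod z = 1"
    hence "z \<noteq> 0" by auto
    thus "z ^ k = z ^ m * (1 / z) ^ (m - k)" by (rule eq)
  qed simp
  show "ddbar (\<lambda>z. z ^ k) z = 0"
    unfolding ddbar_def d by (rule has_wirtinger_imp(2)[OF has_wirtinger_const])
  show "glue m (\<lambda>z. z ^ k) (\<lambda>w. w ^ (m - k)) = (\<lambda>z. z ^ k)"
  proof (rule ext)
    fix z show "glue m (\<lambda>z. z ^ k) (\<lambda>w. w ^ (m - k)) z = z ^ k"
      using eq[of z] by (cases "z = 0") (simp_all add: glue_def)
  qed
qed

section \<open>Bessel functions\<close>

text \<open>The entire function with \<open>J_k(z) = (z/2)^k E_k((z/2)^2)\<close>.\<close>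

definition bessel_E_coeff :: "nat \<Rightarrow> nat \<Rightarrow> complex" where
  "bessel_E_coeff k j = (- 1) ^ j / (fact j * fact (j + k))"

definition bessel_E :: "nat \<Rightarrow> complex \<Rightarrow> complex" where
  "bessel_E k x = (\<Sum>j. bessel_E_coeff k j * x ^ j)"

lemma summable_bessel_E: "summable (\<lambda>j. bessel_E_coeff k j * x ^ j)"
proof (rule summable_comparison_test'[OF summable_exp[of "norm x"]])
  fix j :: nat
  have "(1::real) \<le> fact (j + k)" by (rule fact_ge_1)
  hence "norm (bessel_E_coeff k j) \<le> inverse (fact j)"
    by (simp add: bessel_E_coeff_def norm_divide norm_power norm_mult norm_fact field_simps)
  thus "norm (bessel_E_coeff k j * x ^ j) \<le> inverse (fact j) * norm x ^ j"
    by (simp add: norm_mult norm_power mult_right_mono)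
qed

lemma bessel_E_deriv: "(bessel_E k has_field_derivative - bessel_E (Suc k) x) (at x)"
proof -
  have "diffs (bessel_E_coeff k) j = - bessel_E_coeff (Suc k) j" for j
    by (simp add: diffs_def bessel_E_coeff_def del: of_nat_Suc)
  hence "(\<Sum>j. diffs (bessel_E_coeff k) j * x ^ j) = - bessel_E (Suc k) x"
    using suminf_minus[OF summable_bessel_E[of "Suc k" x]] by (simp add: bessel_E_def)
  moreover have "((\<lambda>x. \<Sum>j. bessel_E_coeff k j * x ^ j) has_field_derivative
      (\<Sum>j. diffs (bessel_E_coeff k) j * x ^ j)) (at x)"
    by (rule termdiffs_strong_converges_everywhere) (rule summable_bessel_E)
  ultimately show ?thesis by (simp add: bessel_E_def[abs_def])
qed

lemma bessel_E_recurrence: "of_nat (Suc k) * bessel_E (Suc k) x - x * bessel_E (Suc (Suc k)) x = bessel_E k x"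
proof -
  let ?c = "\<lambda>j. (of_nat (Suc k) * bessel_E_coeff (Suc k) j - bessel_E_coeff k j) * x ^ j"
  have sm: "summable ?c"
    using summable_diff[OF summable_mult[OF summable_bessel_E[of "Suc k" x], of "of_nat (Suc k)"] summable_bessel_E[of k x]]
    by (simp add: algebra_simps)
  have "of_nat (Suc k) * bessel_E (Suc k) x - bessel_E k x = (\<Sum>j. ?c j)"
    unfolding bessel_E_def suminf_mult[OF summable_bessel_E, symmetric]
    by (subst suminf_diff[OF summable_mult[OF summable_bessel_E] summable_bessel_E])
      (simp add: algebra_simps)
  also have "\<dots> = ?c 0 + (\<Sum>j. ?c (Suc j))"
    using suminf_split_head[OF sm] by simp
  also have "?c 0 = 0"
    by (simp add: bessel_E_coeff_def del: of_nat_Suc)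
  also have "(\<lambda>j. ?c (Suc j)) = (\<lambda>j. x * (bessel_E_coeff (Suc (Suc k)) j * x ^ j))"
  proof (rule ext)
    fix j
    have key: "of_nat (Suc k) * bessel_E_coeff (Suc k) (Suc j) - bessel_E_coeff k (Suc j) = bessel_E_coeff (Suc (Suc k)) j"
    proof -
      define F :: complex where "F = fact (Suc j + k)"
      define N :: complex where "N = of_nat (Suc (Suc (j + k)))"
      define M :: complex where "M = of_nat (Suc j)"
      have nz: "F \<noteq> 0" "N \<noteq> 0" "M \<noteq> 0"
        unfolding F_def N_def M_def by (simp_all only: fact_nonzero of_nat_neq_0 not_False_eq_True)
      have f1: "fact (Suc j + Suc k) = N * F" "fact (j + Suc (Suc k)) = N * F" "fact (Suc j + k) = F"
        "fact (Suc j) = M * (fact j :: complex)"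
        unfolding F_def N_def M_def by (simp_all del: of_nat_Suc)
      have e: "of_nat (Suc k) = N - M" unfolding N_def M_def by simp
      show ?thesis
        unfolding bessel_E_coeff_def f1 e using nz by (simp add: field_simps)
    qed
    show "?c (Suc j) = x * (bessel_E_coeff (Suc (Suc k)) j * x ^ j)"
      unfolding key by simp
  qed
  also have "(\<Sum>j. x * (bessel_E_coeff (Suc (Suc k)) j * x ^ j)) = x * bessel_E (Suc (Suc k)) x"
    unfolding bessel_E_def by (rule suminf_mult[OF summable_bessel_E])
  finally show ?thesis by (simp add: algebra_simps)
qed

lemma bessel_J_nat_eq: "bessel_J_nat k z = (z / 2) ^ k * bessel_E k (z\<^sup>2 / 4)"
proof -
  have "(- 1) ^ j / (fact j * fact (j + k)) * (z / 2) ^ (2 * j + k)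
      = (z / 2) ^ k * (bessel_E_coeff k j * (z\<^sup>2 / 4) ^ j)" for j
  proof -
    have q: "z\<^sup>2 / 4 = (z / 2)\<^sup>2" by (simp add: power_divide)
    have "(z / 2) ^ (2 * j + k) = (z / 2) ^ k * (z\<^sup>2 / 4) ^ j"
      unfolding q by (simp only: power_add power_mult) (rule mult.commute)
    thus ?thesis by (simp add: bessel_E_coeff_def)
  qed
  thus ?thesis
    unfolding bessel_J_nat_def bessel_E_def by (simp only: suminf_mult[OF summable_bessel_E])
qed

lemma bessel_J_minus: "bessel_J (- n) z = (- 1) ^ nat \<bar>n\<bar> * bessel_J n z"
  by (cases n "0::int" rule: linorder_cases)
    (auto simp: bessel_J_def simp flip: mult.assoc power_mult_distrib)

lemma bessel_J_of_nat: "bessel_J (int k) z = (z / 2) ^ k * bessel_E k (z\<^sup>2 / 4)"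
  by (simp add: bessel_J_def bessel_J_nat_eq)

lemma int_reflect_cases [case_names nonneg neg]:
  assumes "\<And>k. P (int k)" "\<And>k. P (int k) \<Longrightarrow> P (- int k)"
  shows "P n"
  using assms by (cases n rule: int_cases2) auto

lemma minus_one_nat_abs_Suc:
  "(- 1 :: complex) ^ nat \<bar>n + 1\<bar> = - ((- 1) ^ nat \<bar>n\<bar>)" "(- 1 :: complex) ^ nat \<bar>n - 1\<bar> = - ((- 1) ^ nat \<bar>n\<bar>)"
proof -
  have "even (nat \<bar>n + 1\<bar>) \<longleftrightarrow> odd (nat \<bar>n\<bar>)" "even (nat \<bar>n - 1\<bar>) \<longleftrightarrow> odd (nat \<bar>n\<bar>)"
    by (simp_all add: even_nat_iff)
  thus "(- 1 :: complex) ^ nat \<bar>n + 1\<bar> = - ((- 1) ^ nat \<bar>n\<bar>)" "(- 1 :: complex) ^ nat \<bar>n - 1\<bar> = - ((- 1) ^ nat \<bar>n\<bar>)"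
    by (cases "even (nat \<bar>n\<bar>)"; simp)+
qed

lemma bessel_J_minus_shift:
  "bessel_J (- n - 1) z = - ((- 1) ^ nat \<bar>n\<bar>) * bessel_J (n + 1) z"
  "bessel_J (- n + 1) z = - ((- 1) ^ nat \<bar>n\<bar>) * bessel_J (n - 1) z"
  using bessel_J_minus[of "n + 1" z] bessel_J_minus[of "n - 1" z]
  by (simp_all add: minus_one_nat_abs_Suc)

lemma bessel_J_recurrence: "z * (bessel_J (n - 1) z + bessel_J (n + 1) z) = 2 * of_int n * bessel_J n z"
proof (induction n rule: int_reflect_cases)
  case (nonneg k)
  show ?case
  proof (cases k)
    case 0
    thus ?thesis using bessel_J_minus[of 1 z] by simp
  next
    case (Suc l)
    have "bessel_J (int k - 1) z = bessel_J (int l) z" "bessel_J (int k + 1) z = bessel_J (int (Suc (Suc l))) z"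
      using Suc by (simp_all add: algebra_simps)
    moreover have "2 * w * (w ^ l * (c * e - w\<^sup>2 * e') + w ^ Suc (Suc l) * e') = 2 * c * (w ^ Suc l * e)"
      for w c e e' :: complex
      by (simp add: algebra_simps power2_eq_square)
    from this[of "z / 2" "of_nat (Suc l)" "bessel_E (Suc l) (z\<^sup>2 / 4)" "bessel_E (Suc (Suc l)) (z\<^sup>2 / 4)"]
    have "z * ((z / 2) ^ l * bessel_E l (z\<^sup>2 / 4) + (z / 2) ^ Suc (Suc l) * bessel_E (Suc (Suc l)) (z\<^sup>2 / 4))
        = 2 * of_nat (Suc l) * ((z / 2) ^ Suc l * bessel_E (Suc l) (z\<^sup>2 / 4))"
      by (simp only: bessel_E_recurrence[of l "z\<^sup>2 / 4", symmetric] power_divide) simp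
    ultimately show ?thesis
      unfolding Suc by (simp only: bessel_J_of_nat of_int_of_nat_eq)
  qed
next
  case (neg k)
  have "z * (bessel_J (- int k - 1) z + bessel_J (- int k + 1) z)
      = - ((- 1) ^ k) * (z * (bessel_J (int k - 1) z + bessel_J (int k + 1) z))"
    unfolding bessel_J_minus_shift by (simp add: algebra_simps)
  also have "\<dots> = 2 * of_int (- int k) * ((- 1) ^ k * bessel_J (int k) z)"
    unfolding neg by simp
  also have "(- 1) ^ k * bessel_J (int k) z = bessel_J (- int k) z"
    using bessel_J_minus[of "int k" z] by simp
  finally show ?case .
qed

lemma bessel_J_deriv: "(bessel_J n has_field_derivative (bessel_J (n - 1) z - bessel_J (n + 1) z) / 2) (at z)"
proof (induction n rule: int_reflect_cases)
  case (nonneg k)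
  have J: "bessel_J (int k) = (\<lambda>z. (z / 2) ^ k * bessel_E k (z\<^sup>2 / 4))"
    by (rule ext) (rule bessel_J_of_nat)
  have E: "((\<lambda>z. bessel_E k (z\<^sup>2 / 4)) has_field_derivative - bessel_E (Suc k) (z\<^sup>2 / 4) * (2 * z / 4)) (at z)"
    by (rule DERIV_chain2[OF bessel_E_deriv]) (auto intro!: derivative_eq_intros)
  have P: "((\<lambda>z::complex. (z / 2) ^ k) has_field_derivative of_nat k * (z / 2) ^ (k - 1) * (1 / 2)) (at z)"
    using DERIV_power[OF DERIV_cdivide[OF DERIV_ident, of 2], of k z] by (simp add: mult_ac)
  have D: "(bessel_J (int k) has_field_derivative (z / 2) ^ k * (- bessel_E (Suc k) (z\<^sup>2 / 4) * (2 * z / 4))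
      + of_nat k * (z / 2) ^ (k - 1) * (1 / 2) * bessel_E k (z\<^sup>2 / 4)) (at z)"
    unfolding J by (rule DERIV_mult'[OF P E])
  show ?case
  proof (cases k)
    case 0
    have "bessel_J (- 1) z = - bessel_J 1 z" using bessel_J_minus[of 1 z] by simp
    thus ?thesis using D bessel_J_of_nat[of "Suc 0" z] 0 by (simp add: algebra_simps)
  next
    case (Suc l)
    have "bessel_J (int k - 1) z = bessel_J (int l) z" "bessel_J (int k + 1) z = bessel_J (int (Suc (Suc l))) z"
      using Suc by (simp_all add: algebra_simps)
    hence "(z / 2) ^ k * (- bessel_E (Suc k) (z\<^sup>2 / 4) * (2 * z / 4))
      + of_nat k * (z / 2) ^ (k - 1) * (1 / 2) * bessel_E k (z\<^sup>2 / 4) = (bessel_J (int k - 1) z - bessel_J (int k + 1) z) / 2"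
      unfolding Suc
      by (simp only: bessel_J_of_nat bessel_E_recurrence[of l "z\<^sup>2 / 4", symmetric])
        (simp add: field_simps power2_eq_square)
    with D show ?thesis by (simp only:)
  qed
next
  case (neg k)
  have J: "bessel_J (- int k) = (\<lambda>z. (- 1) ^ k * bessel_J (int k) z)"
    using bessel_J_minus[of "int k"] by auto
  have "((\<lambda>z. (- 1) ^ k * bessel_J (int k) z) has_field_derivative
      (- 1) ^ k * ((bessel_J (int k - 1) z - bessel_J (int k + 1) z) / 2)) (at z)"
    by (rule DERIV_cmult[OF neg])
  thus ?case
    unfolding bessel_J_minus_shift unfolding J by (simp add: algebra_simps)
qed

text \<open>The determinant of the linear system \<open>bessel_matching\<close> below.\<close>

definition bessel_det :: "nat \<Rightarrow> int \<Rightarrow> complex \<Rightarrow> complex" where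
  "bessel_det m n \<mu> = bessel_J n \<mu> * bessel_J (int m - n + 1) \<mu> + bessel_J (int m - n) \<mu> * bessel_J (n + 1) \<mu>"

lemma bessel_det_sym: "bessel_det m (int m - n) \<mu> = bessel_det m n \<mu>"
  by (simp add: bessel_det_def algebra_simps)

text \<open>
  With \<open>z J_n' = n J_n - z J_(n+1)\<close> and \<open>z J_(n-m)' = z J_(n-m-1) - (n-m) J_(n-m)\<close> the terms
  without derivatives cancel against the derivative of \<open>z^(-m)\<close>.
\<close>

lemma bessel_L_eq_det:
  assumes "\<mu> \<noteq> 0"
  shows "bessel_L m n \<mu> = (- 1) ^ nat \<bar>int m - n\<bar> * bessel_det m n \<mu>"
proof -
  define J where "J = (\<lambda>n. bessel_J n \<mu>)"
  define p where "p = int m - n"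
  have P: "((\<lambda>w. w powi (- int m)) has_field_derivative of_int (- int m) * \<mu> powi (- int m - 1) * 1) (at \<mu>)"
    using assms by (intro DERIV_power_int) auto
  have "((\<lambda>w. w powi (- int m) * bessel_J n w * bessel_J (n - int m) w) has_field_derivative
      (\<mu> powi (- int m) * J n) * ((J (n - int m - 1) - J (n - int m + 1)) / 2)
      + (\<mu> powi (- int m) * ((J (n - 1) - J (n + 1)) / 2) + of_int (- int m) * \<mu> powi (- int m - 1) * 1 * J n) * J (n - int m)) (at \<mu>)"
    unfolding J_def by (intro DERIV_mult' P bessel_J_deriv)
  hence "bessel_L m n \<mu> = - (\<mu> ^ m) * ((\<mu> powi (- int m) * J n) * ((J (n - int m - 1) - J (n - int m + 1)) / 2)
      + (\<mu> powi (- int m) * ((J (n - 1) - J (n + 1)) / 2) + of_int (- int m) * \<mu> powi (- int m - 1) * J n) * J (n - int m))"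
    by (simp add: bessel_L_def DERIV_imp_deriv)
  also have "\<mu> powi (- int m - 1) = \<mu> powi (- int m) / \<mu>" using assms by (simp add: power_int_diff)
  also have "- (\<mu> ^ m) * ((\<mu> powi (- int m) * J n) * ((J (n - int m - 1) - J (n - int m + 1)) / 2)
      + (\<mu> powi (- int m) * ((J (n - 1) - J (n + 1)) / 2) + of_int (- int m) * (\<mu> powi (- int m) / \<mu>) * J n) * J (n - int m))
    = - (\<mu> ^ m * \<mu> powi (- int m)) * (J n * ((J (n - int m - 1) - J (n - int m + 1)) / 2)
      + (((J (n - 1) - J (n + 1)) / 2) - of_nat m / \<mu> * J n) * J (n - int m))"
    by (simp add: algebra_simps)
  also have "\<mu> ^ m * \<mu> powi (- int m) = 1" using assms by (simp add: power_int_minus)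
  also have "- 1 * (J n * ((J (n - int m - 1) - J (n - int m + 1)) / 2)
      + (((J (n - 1) - J (n + 1)) / 2) - of_nat m / \<mu> * J n) * J (n - int m))
      = J (n + 1) * J (n - int m) - J n * J (n - int m - 1)"
  proof -
    have 1: "J (n - 1) = 2 * of_int n / \<mu> * J n - J (n + 1)"
      using bessel_J_recurrence[of \<mu> n] assms by (simp add: J_def field_simps)
    have 2: "J (n - int m + 1) = 2 * (of_int n - of_nat m) / \<mu> * J (n - int m) - J (n - int m - 1)"
      using bessel_J_recurrence[of \<mu> "n - int m"] assms by (simp add: J_def field_simps)
    show ?thesis unfolding 1 2 using assms by (simp add: field_simps)
  qed
  also have "J (n - int m) = (- 1) ^ nat \<bar>p\<bar> * J p"
    using bessel_J_minus[of p \<mu>] by (simp add: J_def p_def)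
  also have "J (n - int m - 1) = - ((- 1) ^ nat \<bar>p\<bar>) * J (p + 1)"
    using bessel_J_minus_shift(1)[of p \<mu>] by (simp add: J_def p_def)
  finally show ?thesis by (simp add: bessel_det_def J_def p_def algebra_simps)
qed

lemma bessel_Z_det: "\<mu> \<in> bessel_Z m n \<longleftrightarrow> \<mu> \<noteq> 0 \<and> bessel_det m n \<mu> = 0"
  using bessel_L_eq_det[of \<mu> m n] by (auto simp: bessel_Z_def)

section \<open>Bessel modes\<close>

text \<open>\<open>J_n(\<mu> r) e^{i n theta}\<close>, in a form that shows its smoothness at the origin.\<close>

definition bessel_mode :: "int \<Rightarrow> complex \<Rightarrow> complex \<Rightarrow> complex" where
  "bessel_mode n \<mu> z =
     (if 0 \<le> n then (\<mu> * z / 2) ^ nat n * bessel_E (nat n) (\<mu>\<^sup>2 * (z * cnj z) / 4)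
      else (- \<mu> * cnj z / 2) ^ nat (- n) * bessel_E (nat (- n)) (\<mu>\<^sup>2 * (z * cnj z) / 4))"

lemma bessel_mode_of_nat:
  "bessel_mode (int k) \<mu> z = (\<mu> * z / 2) ^ k * bessel_E k (\<mu>\<^sup>2 * (z * cnj z) / 4)"
  by (simp add: bessel_mode_def)

lemma bessel_mode_minus: "bessel_mode (- n) \<mu> z = bessel_mode n (- \<mu>) (cnj z)"
  by (simp add: bessel_mode_def mult.commute)

lemma bessel_mode_polar:
  "bessel_mode n \<mu> (of_real r * cis \<theta>) = bessel_J n (\<mu> * of_real r) * cis (of_int n * \<theta>)"
proof -
  have c: "\<mu>\<^sup>2 * ((of_real r * cis \<theta>) * cnj (of_real r * cis \<theta>)) / 4 = (\<mu> * of_real r)\<^sup>2 / 4"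
    by (simp add: power_mult_distrib power2_eq_square cis_mult cis_cnj mult_ac)
  show ?thesis
  proof (cases "0 \<le> n")
    case True
    then obtain k where k: "n = int k" using nonneg_int_cases by blast
    have "(\<mu> * (of_real r * cis \<theta>) / 2) ^ k = (\<mu> * of_real r / 2) ^ k * cis (real k * \<theta>)"
      by (simp add: power_mult_distrib power_divide Complex.DeMoivre)
    thus ?thesis unfolding k bessel_mode_of_nat bessel_J_of_nat c by simp
  next
    case False
    define k where "k = nat (- n)"
    have n: "n = - int k" using False by (simp add: k_def)
    have "(- \<mu> * cnj (of_real r * cis \<theta>) / 2) ^ k = (- 1) ^ k * (\<mu> * of_real r / 2) ^ k * cis (- (real k * \<theta>))"
      by (simp add: power_mult_distrib power_divide Complex.DeMoivre cis_cnj power_minus')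
    moreover have "bessel_mode n \<mu> (of_real r * cis \<theta>)
      = (- \<mu> * cnj (of_real r * cis \<theta>) / 2) ^ k * bessel_E k (\<mu>\<^sup>2 * ((of_real r * cis \<theta>) * cnj (of_real r * cis \<theta>)) / 4)"
      using False by (simp only: bessel_mode_def k_def if_False)
    ultimately show ?thesis
      unfolding c using bessel_J_minus[of "int k" "\<mu> * of_real r"] by (simp add: n bessel_J_of_nat)
  qed
qed

lemma has_wirtinger_bessel_mode_nat:
  "has_wirtinger (bessel_mode (int k) \<mu>) (\<mu> / 2 * bessel_mode (int k - 1) \<mu> z) (- (\<mu> / 2) * bessel_mode (int k + 1) \<mu> z) z"
proof -
  define X where "X = \<mu>\<^sup>2 * (z * cnj z) / 4"
  have "has_wirtinger (\<lambda>z. \<mu>\<^sup>2 / 4 * (z * cnj z)) (\<mu>\<^sup>2 / 4 * cnj z) (\<mu>\<^sup>2 / 4 * z) z"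
    using has_wirtinger_mult[OF has_wirtinger_const[of "\<mu>\<^sup>2 / 4"] has_wirtinger_mult[OF has_wirtinger_id has_wirtinger_cnj[OF has_wirtinger_id]]]
    by simp
  from has_wirtinger_compose_holomorphic[OF this bessel_E_deriv[of k]]
  have E: "has_wirtinger (\<lambda>z. bessel_E k (\<mu>\<^sup>2 * (z * cnj z) / 4))
      (- bessel_E (Suc k) X * (\<mu>\<^sup>2 / 4 * cnj z)) (- bessel_E (Suc k) X * (\<mu>\<^sup>2 / 4 * z)) z"
    by (simp add: X_def)
  have P: "has_wirtinger (\<lambda>z. (\<mu> * z / 2) ^ k) (of_nat k * (\<mu> * z / 2) ^ (k - 1) * (\<mu> / 2)) 0 z"
    using has_wirtinger_holomorphic[OF DERIV_power[OF DERIV_cdivide[OF DERIV_cmult_Id[of \<mu>], of 2], of k z]]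
    by (simp add: mult_ac)
  have M: "bessel_mode (int k) \<mu> = (\<lambda>z. (\<mu> * z / 2) ^ k * bessel_E k (\<mu>\<^sup>2 * (z * cnj z) / 4))"
    by (rule ext) (rule bessel_mode_of_nat)
  have W: "has_wirtinger (bessel_mode (int k) \<mu>)
      ((\<mu> * z / 2) ^ k * (- bessel_E (Suc k) X * (\<mu>\<^sup>2 / 4 * cnj z)) + of_nat k * (\<mu> * z / 2) ^ (k - 1) * (\<mu> / 2) * bessel_E k X)
      ((\<mu> * z / 2) ^ k * (- bessel_E (Suc k) X * (\<mu>\<^sup>2 / 4 * z)) + 0 * bessel_E k X) z"
    unfolding M using has_wirtinger_mult[OF P E] by (simp only: X_def)
  have q: "(\<mu> * z / 2) ^ k * (- bessel_E (Suc k) X * (\<mu>\<^sup>2 / 4 * z)) + 0 * bessel_E k X = - (\<mu> / 2) * bessel_mode (int k + 1) \<mu> z"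
  proof -
    have "bessel_mode (int k + 1) \<mu> z = (\<mu> * z / 2) ^ Suc k * bessel_E (Suc k) X"
      using bessel_mode_of_nat[of "Suc k" \<mu> z] by (simp add: X_def add.commute)
    thus ?thesis by (simp add: power2_eq_square)
  qed
  have p: "(\<mu> * z / 2) ^ k * (- bessel_E (Suc k) X * (\<mu>\<^sup>2 / 4 * cnj z)) + of_nat k * (\<mu> * z / 2) ^ (k - 1) * (\<mu> / 2) * bessel_E k X
      = \<mu> / 2 * bessel_mode (int k - 1) \<mu> z"
  proof (cases k)
    case 0
    thus ?thesis by (simp add: bessel_mode_def X_def power2_eq_square)
  next
    case (Suc l)
    have "bessel_mode (int k - 1) \<mu> z = (\<mu> * z / 2) ^ l * bessel_E l X"
      using bessel_mode_of_nat[of l \<mu> z] Suc by (simp add: X_def)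
    also have "\<dots> = (\<mu> * z / 2) ^ l * (of_nat (Suc l) * bessel_E (Suc l) X - X * bessel_E (Suc (Suc l)) X)"
      by (simp only: bessel_E_recurrence)
    finally have B: "bessel_mode (int k - 1) \<mu> z
      = (\<mu> * z / 2) ^ l * (of_nat (Suc l) * bessel_E (Suc l) X - X * bessel_E (Suc (Suc l)) X)" .
    have X: "\<mu> * z / 2 * (\<mu>\<^sup>2 / 4 * cnj z) = \<mu> / 2 * X"
      by (simp add: X_def power2_eq_square)
    have "(\<mu> * z / 2) ^ k * (- bessel_E (Suc k) X * (\<mu>\<^sup>2 / 4 * cnj z))
        = - ((\<mu> * z / 2) ^ l * bessel_E (Suc k) X * (\<mu> * z / 2 * (\<mu>\<^sup>2 / 4 * cnj z)))"
      unfolding Suc by (simp only: power_Suc mult_ac mult_minus_left mult_minus_right)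
    hence A: "(\<mu> * z / 2) ^ k * (- bessel_E (Suc k) X * (\<mu>\<^sup>2 / 4 * cnj z))
        = - ((\<mu> * z / 2) ^ l * bessel_E (Suc k) X * (\<mu> / 2 * X))"
      by (simp only: X)
    show ?thesis unfolding A B unfolding Suc by (simp add: algebra_simps)
  qed
  show ?thesis using W unfolding p q .
qed

lemma has_wirtinger_reflect:
  assumes "has_wirtinger g p q (cnj z)"
  shows "has_wirtinger (\<lambda>z. g (cnj z)) q p z"
proof -
  have "(cnj has_derivative cnj) (at z)"
    by (rule bounded_linear_imp_has_derivative[OF bounded_linear_cnj])
  from has_derivative_compose[OF this assms[unfolded has_wirtinger_def]]
  show ?thesis by (simp add: has_wirtinger_def add.commute)
qed

lemma has_wirtinger_bessel_mode:
  "has_wirtinger (bessel_mode n \<mu>) (\<mu> / 2 * bessel_mode (n - 1) \<mu> z) (- (\<mu> / 2) * bessel_mode (n + 1) \<mu> z) z"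
proof (cases "0 \<le> n")
  case True
  thus ?thesis using has_wirtinger_bessel_mode_nat[of "nat n" \<mu> z] by simp
next
  case False
  define k where "k = nat (- n)"
  have n: "n = - int k" using False by (simp add: k_def)
  have M: "bessel_mode n \<mu> = (\<lambda>z. bessel_mode (int k) (- \<mu>) (cnj z))"
    by (rule ext) (simp only: n bessel_mode_minus)
  have "n - 1 = - (int k + 1)" "n + 1 = - (int k - 1)" by (simp_all add: n)
  hence e: "\<mu> / 2 * bessel_mode (n - 1) \<mu> z = - (- \<mu> / 2) * bessel_mode (int k + 1) (- \<mu>) (cnj z)"
    "- (\<mu> / 2) * bessel_mode (n + 1) \<mu> z = - \<mu> / 2 * bessel_mode (int k - 1) (- \<mu>) (cnj z)"
    by (simp_all only: bessel_mode_minus) simp_all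
  show ?thesis
    unfolding M e by (rule has_wirtinger_reflect[OF has_wirtinger_bessel_mode_nat])
qed

text \<open>
  The modes are closed under both Wirtinger derivatives up to constants, so the induction on the
  order of differentiability goes through for all n at once.
\<close>

lemma smooth_bessel_mode: "smooth (bessel_mode n \<mu>)"
proof -
  have "cont_diff k (bessel_mode n \<mu>)" for k
  proof (induction k arbitrary: n)
    case 0
    show ?case
      using has_wirtinger_isCont[OF has_wirtinger_bessel_mode[of n \<mu>]]
      by (simp add: continuous_at_imp_continuous_on)
  next
    case (Suc k)
    show ?case
      by (rule cont_diff_SucI[OF has_wirtinger_bessel_mode]) (intro cont_diff_cmult Suc.IH)+
  qed
  thus ?thesis by (simp add: smooth_def)
qed

lemma has_wirtinger_cmult:
  "has_wirtinger f p q z \<Longrightarrow> has_wirtinger (\<lambda>z. c * f z) (c * p) (c * q) z"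
  using has_wirtinger_mult[OF has_wirtinger_const] by fastforce

lemma d_zbar_bessel_mode:
  "d_zbar (\<lambda>z. a * bessel_mode n \<mu> z) = (\<lambda>z. - (\<mu> / 2) * a * bessel_mode (n + 1) \<mu> z)"
  using has_wirtinger_imp(3)[OF has_wirtinger_cmult[OF has_wirtinger_bessel_mode]]
  by (intro ext) (simp add: mult_ac)

lemma ddbar_bessel_mode:
  "ddbar (\<lambda>z. a * bessel_mode n \<mu> z) z = - (\<mu>\<^sup>2 / 4) * (a * bessel_mode n \<mu> z)"
  unfolding ddbar_def d_zbar_bessel_mode
  using has_wirtinger_imp(2)[OF has_wirtinger_cmult[OF has_wirtinger_bessel_mode[of "n + 1" \<mu> z], of "- (\<mu> / 2) * a"]]
  by (simp add: power2_eq_square)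

definition bessel_section :: "nat \<Rightarrow> int \<Rightarrow> complex \<Rightarrow> complex \<Rightarrow> complex \<Rightarrow> complex \<Rightarrow> complex" where
  "bessel_section m n \<mu> a b = glue m (\<lambda>z. a * bessel_mode n \<mu> z) (\<lambda>w. b * bessel_mode (int m - n) \<mu> w)"

text \<open>
  What \<open>matched\<close> amounts to for these coefficients, the dependence on the angle being the same on
  both sides.
\<close>

definition bessel_matching :: "nat \<Rightarrow> int \<Rightarrow> complex \<Rightarrow> complex \<Rightarrow> complex \<Rightarrow> bool" where
  "bessel_matching m n \<mu> a b \<longleftrightarrow>
     a * bessel_J n \<mu> = b * bessel_J (int m - n) \<mu> \<and>
     a * bessel_J (n + 1) \<mu> = - b * bessel_J (int m - n + 1) \<mu>"

lemma matched_bessel: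
  assumes "bessel_matching m n \<mu> a b"
  shows "matched m (\<lambda>z. a * bessel_mode n \<mu> z) (\<lambda>w. b * bessel_mode (int m - n) \<mu> w)"
  unfolding matched_def d_zbar_bessel_mode
proof (intro conjI allI impI smooth_mult smooth_const smooth_bessel_mode)
  fix z :: complex assume z: "cmod z = 1"
  define t where "t = Arg z"
  have zt: "z = of_real 1 * cis t" using z rcis_cmod_Arg[of z] by (simp add: t_def rcis_def)
  have iz: "1 / z = of_real 1 * cis (- t)" by (simp add: zt cis_divide flip: cis_zero)
  have J: "a * bessel_J n \<mu> = b * bessel_J (int m - n) \<mu>"
    "a * bessel_J (n + 1) \<mu> = - b * bessel_J (int m - n + 1) \<mu>"
    using assms by (simp_all add: bessel_matching_def)
  have pw: "z ^ k = cis (real k * t)" for k by (simp add: zt Complex.DeMoivre)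
  have M1: "bessel_mode j \<mu> z = bessel_J j \<mu> * cis (of_int j * t)" for j
    using bessel_mode_polar[of j \<mu> 1 t] by (simp only: zt) simp
  have M2: "bessel_mode j \<mu> (1 / z) = bessel_J j \<mu> * cis (of_int j * (- t))" for j
    using bessel_mode_polar[of j \<mu> 1 "- t"] by (simp only: iz) simp
  have "z ^ m * (b * bessel_mode (int m - n) \<mu> (1 / z))
      = b * bessel_J (int m - n) \<mu> * (cis (real m * t) * cis (of_int (int m - n) * (- t)))"
    by (simp only: M2 pw mult_ac)
  also have "cis (real m * t) * cis (of_int (int m - n) * (- t)) = cis (of_int n * t)"
    unfolding cis_mult by (rule arg_cong[of _ _ cis]) (simp add: algebra_simps)
  finally show "a * bessel_mode n \<mu> z = z ^ m * (b * bessel_mode (int m - n) \<mu> (1 / z))"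
    by (simp only: M1 J(1) mult.assoc[symmetric])
  have "- (z ^ (m + 2)) * (- (\<mu> / 2) * b * bessel_mode (int m - n + 1) \<mu> (1 / z))
      = - (\<mu> / 2) * (- b * bessel_J (int m - n + 1) \<mu>) * (cis (real (m + 2) * t) * cis (of_int (int m - n + 1) * (- t)))"
    unfolding M2 pw by simp
  also have "cis (real (m + 2) * t) * cis (of_int (int m - n + 1) * (- t)) = cis (of_int (n + 1) * t)"
    unfolding cis_mult by (rule arg_cong[of _ _ cis]) (simp add: algebra_simps)
  finally show "- (\<mu> / 2) * a * bessel_mode (n + 1) \<mu> z
      = - (z ^ (m + 2)) * (- (\<mu> / 2) * b * bessel_mode (int m - n + 1) \<mu> (1 / z))"
    by (simp only: M1 J(2)[symmetric] mult.assoc)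
qed

lemma bessel_section_eigen:
  assumes "bessel_matching m n \<mu> a b" "\<xi> \<in> smooth_sections m"
  shows "L2_inner m (bessel_section m n \<mu> a b) (laplacian m \<xi>)
    = \<mu>\<^sup>2 / 4 * L2_inner m (bessel_section m n \<mu> a b) \<xi>"
  unfolding bessel_section_def
  by (rule weak_eigensection[OF matched_bessel[OF assms(1)] ddbar_bessel_mode ddbar_bessel_mode assms(2)])

section \<open>Sections in the Hilbert completion\<close>

lemma square_integrable_glue:
  assumes "continuous_on UNIV A" "continuous_on UNIV B"
  shows "square_integrable m (glue m A B)"
proof -
  let ?\<phi> = "glue m A B"
  have [measurable]: "?\<phi> \<in> borel_measurable borel" by (rule glue_borel[OF assms])
  have eq: "(1 / (pi * max 1 (cmod z) ^ 4)) *\<^sub>R h_metric m z (?\<phi> z) (?\<phi> z)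
      = 1 / pi * two_charts (\<lambda>z. A z * cnj (A z)) (\<lambda>z. B z * cnj (B z)) z" for z
  proof (cases "cmod z < 1")
    case True
    thus ?thesis by (simp add: glue_def h_metric_def two_charts_def scaleR_conv_of_real)
  next
    case False
    have "complex_of_real (cmod z ^ (2 * m)) = complex_of_real ((cmod z)\<^sup>2) ^ m" by (simp add: power_mult)
    also have "\<dots> = (z * cnj z) ^ m" by (simp only: complex_norm_square)
    finally have n: "complex_of_real (cmod z ^ (2 * m)) = z ^ m * cnj z ^ m" by (simp add: power_mult_distrib)
    have "max 1 (cmod z) = cmod z" "z \<noteq> 0" using False by auto
    thus ?thesis using False unfolding glue_def h_metric_def two_charts_def
      by (simp add: n scaleR_conv_of_real del: of_real_power)
  qed
  have "integrable lborel (\<lambda>z. (1 / (pi * max 1 (cmod z) ^ 4)) *\<^sub>R h_metric m z (?\<phi> z) (?\<phi> z))"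
    unfolding eq using assms
    by (intro integrable_mult_right integrable_two_charts) (auto intro!: continuous_intros)
  hence "integrable omega_inf (\<lambda>z. h_metric m z (?\<phi> z) (?\<phi> z))"
    unfolding omega_inf_def
    by (subst integrable_density) (auto simp: h_metric_def simp del: of_real_power)
  thus ?thesis by (simp add: square_integrable_def omega_inf_def)
qed

lemma smooth_section_in_completion:
  assumes "\<xi> \<in> smooth_sections m"
  shows "\<xi> \<in> hilbert_completion m"
proof -
  obtain t where s: "smooth \<xi>" "smooth t" "\<And>w. w \<noteq> 0 \<Longrightarrow> t w = w ^ m * \<xi> (1 / w)"
    using smooth_sections_obtain[OF assms] by blast
  have "\<xi> = glue m \<xi> t" by (rule smooth_sections_charts(3)[OF s])
  hence "square_integrable m \<xi>"
    using square_integrable_glue[of \<xi> t m] smooth_continuous_on[OF s(1)] smooth_continuous_on[OF s(2)] by simp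
  moreover have "(\<lambda>j::nat. L2_inner m (\<lambda>z. \<xi> z - \<xi> z) (\<lambda>z. \<xi> z - \<xi> z)) \<longlonglongrightarrow> 0"
    by (simp add: L2_inner_def h_metric_def)
  ultimately show ?thesis
    unfolding hilbert_completion_def using assms by (auto intro!: exI[of _ "\<lambda>_. \<xi>"])
qed

text \<open>The volume of the sphere is finite, so uniform closeness in the metric suffices.\<close>

lemma uniform_limit_in_completion:
  assumes \<phi>: "square_integrable m \<phi>"
    and approx: "\<And>e. e > 0 \<Longrightarrow> \<exists>\<xi>\<in>smooth_sections m. \<forall>z. cmod (\<phi> z - \<xi> z) \<le> e * max 1 (cmod z) ^ m"
  shows "\<phi> \<in> hilbert_completion m"
proof -
  have "\<forall>j. \<exists>\<xi>. \<xi> \<in> smooth_sections m \<and> (\<forall>z. cmod (\<phi> z - \<xi> z) \<le> (1 / real (Suc j)) * max 1 (cmod z) ^ m)"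
    using approx[of "1 / real (Suc _)"] by (simp add: Bex_def)
  then obtain \<xi> where \<xi>: "\<And>j. \<xi> j \<in> smooth_sections m"
    "\<And>j z. cmod (\<phi> z - \<xi> j z) \<le> (1 / real (Suc j)) * max 1 (cmod z) ^ m"
    using choice[of "\<lambda>j \<xi>. \<xi> \<in> smooth_sections m \<and> (\<forall>z. cmod (\<phi> z - \<xi> z) \<le> (1 / real (Suc j)) * max 1 (cmod z) ^ m)"] by blast
  have [measurable]: "\<phi> \<in> borel_measurable borel" using \<phi> by (simp add: square_integrable_def omega_inf_def)
  have [measurable]: "\<xi> j \<in> borel_measurable borel" for j
    using \<xi>(1)[of j] by (auto simp: smooth_sections_def intro: smooth_borel)
  define C where "C = (LINT z::complex|lborel. 1 / max 1 (cmod z) ^ 3)"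
  have "cmod (L2_inner m (\<lambda>z. \<phi> z - \<xi> j z) (\<lambda>z. \<phi> z - \<xi> j z)) \<le> C / pi * (1 / real (Suc j))\<^sup>2" for j
  proof -
    define e where "e = 1 / real (Suc j)"
    define d where "d = (\<lambda>z. \<phi> z - \<xi> j z)"
    have d: "cmod (d z) \<le> e * max 1 (cmod z) ^ m" for z using \<xi>(2) by (simp add: d_def e_def)
    have [measurable]: "d \<in> borel_measurable borel" unfolding d_def by measurable
    have pw: "norm (d z * cnj (d z) / of_real (max 1 (cmod z) ^ (2 * m + 4))) \<le> e\<^sup>2 * (1 / max 1 (cmod z) ^ 3)" for z
    proof -
      define M where "M = max 1 (cmod z)"
      have M: "M \<ge> 1" by (simp add: M_def)
      have "cmod (d z) * cmod (d z) \<le> (e * M ^ m) * (e * M ^ m)"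
        using d[of z] M by (intro mult_mono) (auto simp: M_def e_def)
      also have "\<dots> = e\<^sup>2 * M ^ (2 * m)" by (simp add: power2_eq_square power_add mult_2)
      finally have "cmod (d z) * cmod (d z) / M ^ (2 * m + 4) \<le> e\<^sup>2 * M ^ (2 * m) / M ^ (2 * m + 4)"
        using M by (intro divide_right_mono) auto
      also have "\<dots> = e\<^sup>2 * (1 / M ^ 4)" using M by (simp add: power_add)
      also have "\<dots> \<le> e\<^sup>2 * (1 / M ^ 3)"
        using M by (intro mult_left_mono divide_left_mono power_increasing) auto
      finally show ?thesis using M by (simp add: norm_divide norm_mult norm_power M_def)
    qed
    have "norm (LINT z|lborel. d z * cnj (d z) / of_real (max 1 (cmod z) ^ (2 * m + 4)))
        \<le> (LINT z::complex|lborel. e\<^sup>2 * (1 / max 1 (cmod z) ^ 3))"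
    proof (rule Bochner_Integration.integral_norm_bound_integral)
      show I: "integrable lborel (\<lambda>z::complex. e\<^sup>2 * (1 / max 1 (cmod z) ^ 3))"
        by (rule integrable_mult_right[OF integrable_plane_weight])
      show "integrable lborel (\<lambda>z. d z * cnj (d z) / of_real (max 1 (cmod z) ^ (2 * m + 4)))"
      proof (rule Bochner_Integration.integrable_bound[OF I])
        show "AE z in lborel. norm (d z * cnj (d z) / of_real (max 1 (cmod z) ^ (2 * m + 4)))
            \<le> norm (e\<^sup>2 * (1 / max 1 (cmod z) ^ 3))"
          by (rule AE_I2, rule order_trans[OF pw]) simp
      qed measurable
    qed (rule pw)
    also have "\<dots> = e\<^sup>2 * C" unfolding C_def by (rule integral_mult_right_zero)
    finally have "norm (1 / complex_of_real pi * (LINT z|lborel. d z * cnj (d z) / of_real (max 1 (cmod z) ^ (2 * m + 4)))) \<le> 1 / pi * (e\<^sup>2 * C)"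
      unfolding norm_mult by (simp add: norm_divide divide_right_mono)
    thus ?thesis
      using L2_inner_lborel[of d d m] by (simp add: d_def e_def mult.commute)
  qed
  note bound = this
  have "(\<lambda>j. C / pi * (1 / real (Suc j))\<^sup>2) \<longlonglongrightarrow> C / pi * 0\<^sup>2"
    by (intro tendsto_mult tendsto_const tendsto_power LIMSEQ_Suc[OF lim_1_over_n])
  hence "(\<lambda>j. C / pi * (1 / real (Suc j))\<^sup>2) \<longlonglongrightarrow> 0" by simp
  hence "(\<lambda>j. L2_inner m (\<lambda>z. \<phi> z - \<xi> j z) (\<lambda>z. \<phi> z - \<xi> j z)) \<longlonglongrightarrow> 0"
    by (rule Lim_null_comparison[rotated]) (intro always_eventually allI bound)
  thus ?thesis unfolding hilbert_completion_def using \<phi> \<xi>(1) by blast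
qed

lemma smooth_real_polynomial_function:
  assumes "real_polynomial_function q" "smooth T"
  shows "smooth (\<lambda>z. complex_of_real (q (Re (T z))))"
  using assms(1)
proof (induction rule: real_polynomial_function.induct)
  case (linear f)
  then interpret bounded_linear f .
  have "complex_of_real (f (Re (T z))) = of_real (f 1) * ((T z + cnj (T z)) / 2)" for z
  proof -
    have "f (Re (T z)) = Re (T z) * f 1" using scaleR[of "Re (T z)" 1] by simp
    thus ?thesis by (simp add: complex_add_cnj)
  qed
  thus ?case using assms(2) by (simp only:) (intro smooth_intros; simp)
next
  case (const c)
  show ?case by (rule smooth_const)
next
  case (add f g)
  thus ?case by (simp only: of_real_add smooth_add)
next
  case (mult f g)
  thus ?case by (simp only: of_real_mult smooth_mult)
qed

lemma smooth_polynomial_function: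
  fixes p :: "real \<Rightarrow> complex"
  assumes "polynomial_function p" "smooth T"
  shows "smooth (\<lambda>z. p (Re (T z)))"
proof -
  have "real_polynomial_function (Re \<circ> p)" "real_polynomial_function (Im \<circ> p)"
    using assms(1) bounded_linear_Re bounded_linear_Im unfolding polynomial_function_def by blast+
  from this[THEN smooth_real_polynomial_function, OF assms(2)]
  have "smooth (\<lambda>z. complex_of_real (Re (p (Re (T z)))) + \<i> * complex_of_real (Im (p (Re (T z)))))"
    by (intro smooth_add smooth_mult smooth_const) simp_all
  thus ?thesis by (simp only: complex_eq[symmetric])
qed

lemma one_plus_norm: "1 + z * cnj z = of_real (1 + (cmod z)\<^sup>2)"
  by (simp only: of_real_add of_real_1 complex_norm_square)

lemma power_eq_quotient: "z \<noteq> (0::complex) \<Longrightarrow> a + b = c \<Longrightarrow> z ^ a = z ^ c / z ^ b"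
  by (auto simp: power_add)

text \<open>
  A section \<open>z^\<alpha> zbar^\<beta> g(|z|^2)\<close> is the smooth section \<open>z^\<alpha> zbar^\<beta> / (1 + |z|^2)^N\<close> times a
  continuous function of the height \<open>\<tau> = |z|^2 / (1 + |z|^2)\<close> on the sphere. By the Weierstrass
  theorem that function is a uniform limit of polynomials in \<open>\<tau>\<close>, and the products of these with
  the smooth section are smooth.
\<close>

lemma radial_section_in_completion:
  fixes g h :: "real \<Rightarrow> complex"
  assumes g: "continuous_on UNIV g" and h: "continuous_on UNIV h" and gh: "g 1 = h 1"
    and deg: "\<alpha> + \<alpha>' = m + \<beta> + \<beta>'"
  shows "glue m (\<lambda>z. z ^ \<alpha> * cnj z ^ \<beta> * g ((cmod z)\<^sup>2)) (\<lambda>w. w ^ \<alpha>' * cnj w ^ \<beta>' * h ((cmod w)\<^sup>2))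
    \<in> hilbert_completion m" (is "glue m ?A ?B \<in> _")
proof (rule uniform_limit_in_completion)
  show "square_integrable m (glue m ?A ?B)"
    by (intro square_integrable_glue continuous_intros continuous_on_compose2[OF g] continuous_on_compose2[OF h]) auto
  fix e :: real assume "e > 0"
  \<comment> \<open>With this N the exponents of the section near infinity, \<open>m + N - \<alpha>\<close> and \<open>N - \<beta>\<close>, are \<open>\<alpha>'\<close> and \<open>\<beta>'\<close>.\<close>
  define N where "N = \<beta> + \<beta>'"
  define G where "G = (\<lambda>\<tau>::real. if \<tau> \<le> 1/2 then g (\<tau> / (1 - \<tau>)) / of_real (1 - \<tau>) ^ N
      else h ((1 - \<tau>) / \<tau>) / of_real \<tau> ^ N)"
  have "continuous_on {0..1} G"
    unfolding G_def
  proof (rule continuous_on_cases_le)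
    show "continuous_on {\<tau> \<in> {0..1}. \<tau> \<le> 1/2} (\<lambda>\<tau>. g (\<tau> / (1 - \<tau>)) / of_real (1 - \<tau>) ^ N)"
      by (intro continuous_intros continuous_on_compose2[OF g]) auto
    show "continuous_on {\<tau> \<in> {0..1}. 1/2 \<le> \<tau>} (\<lambda>\<tau>. h ((1 - \<tau>) / \<tau>) / of_real \<tau> ^ N)"
      by (intro continuous_intros continuous_on_compose2[OF h]) auto
    show "g (\<tau> / (1 - \<tau>)) / of_real (1 - \<tau>) ^ N = h ((1 - \<tau>) / \<tau>) / of_real \<tau> ^ N"
      if "\<tau> \<in> {0..1}" "\<tau> = 1/2" for \<tau>
      unfolding that(2) by (simp add: gh)
  qed (rule continuous_on_id)
  from Stone_Weierstrass_polynomial_function[OF compact_Icc this \<open>e > 0\<close>] obtain p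
    where p: "polynomial_function p" "\<And>\<tau>. \<tau> \<in> {0..1} \<Longrightarrow> norm (G \<tau> - p \<tau>) < e" by blast
  define \<tau> where "\<tau> = (\<lambda>z. (cmod z)\<^sup>2 / (1 + (cmod z)\<^sup>2))"
  have pos: "1 + (cmod z)\<^sup>2 > 0" for z by (intro add_pos_nonneg) auto
  have \<tau>_01: "\<tau> z \<in> {0..1}" for z
    using pos[of z] by (simp add: \<tau>_def)
  define u where "u = (\<lambda>z. z ^ \<alpha> * cnj z ^ \<beta> / (1 + z * cnj z) ^ N)"
  have u_bound: "cmod (u z) \<le> max 1 (cmod z) ^ m" for z
  proof -
    have nu: "cmod (u z) = cmod z ^ (\<alpha> + \<beta>) / (1 + (cmod z)\<^sup>2) ^ N"
      using pos[of z] unfolding u_def one_plus_norm by (simp add: norm_mult norm_divide norm_power power_add del: of_real_add)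
    show ?thesis
    proof (cases "cmod z \<le> 1")
      case True
      have "cmod z ^ (\<alpha> + \<beta>) \<le> 1" using True by (simp add: power_le_one)
      also have "1 \<le> (1 + (cmod z)\<^sup>2) ^ N" by (rule one_le_power) simp
      finally have "cmod (u z) \<le> 1" unfolding nu using pos[of z] by simp
      thus ?thesis using True by (simp add: max_def)
    next
      case False
      hence z1: "cmod z \<ge> 1" by simp
      have "cmod z ^ (\<alpha> + \<beta>) \<le> cmod z ^ (m + 2 * N)"
        using z1 deg by (intro power_increasing) (auto simp: N_def)
      also have "\<dots> = cmod z ^ m * ((cmod z)\<^sup>2) ^ N" by (simp add: power_add power_mult)
      also have "\<dots> \<le> cmod z ^ m * (1 + (cmod z)\<^sup>2) ^ N"
        by (intro mult_left_mono power_mono) auto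
      finally show ?thesis unfolding nu using pos[of z] z1 by (simp add: divide_le_eq max_def)
    qed
  qed
  have factor: "glue m ?A ?B z = u z * G (\<tau> z)" for z
  proof (cases "cmod z < 1")
    case True
    hence lt: "(cmod z)\<^sup>2 < 1" by (simp add: power_less_one_iff abs_square_less_1)
    hence half: "\<tau> z \<le> 1/2" using pos[of z] by (simp add: \<tau>_def field_simps)
    have o: "1 - \<tau> z = 1 / (1 + (cmod z)\<^sup>2)" using pos[of z] by (simp add: \<tau>_def field_simps)
    have r: "\<tau> z / (1 - \<tau> z) = (cmod z)\<^sup>2" unfolding o using pos[of z] by (simp add: \<tau>_def)
    have "G (\<tau> z) = g (\<tau> z / (1 - \<tau> z)) / of_real (1 - \<tau> z) ^ N"
      using half by (simp only: G_def if_True)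
    also have "\<dots> = g ((cmod z)\<^sup>2) / (1 / (1 + z * cnj z)) ^ N"
      unfolding r unfolding o one_plus_norm by (simp only: of_real_divide of_real_1)
    also have "\<dots> = g ((cmod z)\<^sup>2) * (1 + z * cnj z) ^ N" by (simp add: power_one_over)
    finally have "G (\<tau> z) = g ((cmod z)\<^sup>2) * (1 + z * cnj z) ^ N" .
    thus ?thesis using True one_plus_norm_nonzero[of z] by (simp add: glue_def u_def)
  next
    case False
    hence z0: "z \<noteq> 0" and ge: "(cmod z)\<^sup>2 \<ge> 1" by (auto simp: one_le_power)
    have iv: "(1 - \<tau> z) / \<tau> z = (cmod (1 / z))\<^sup>2"
      using z0 pos[of z] by (simp add: \<tau>_def norm_divide power_divide field_simps)
    have tz: "of_real (\<tau> z) = z * cnj z / (1 + z * cnj z)"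
      unfolding one_plus_norm by (simp only: \<tau>_def of_real_divide complex_norm_square)
    have G: "G (\<tau> z) = h ((cmod (1 / z))\<^sup>2) / (z * cnj z / (1 + z * cnj z)) ^ N"
    proof (cases "\<tau> z \<le> 1/2")
      case True
      hence "(cmod z)\<^sup>2 = 1" using ge pos[of z] by (simp add: \<tau>_def field_simps)
      hence half: "\<tau> z = 1/2" and one: "(cmod (1 / z))\<^sup>2 = 1" by (simp_all add: \<tau>_def norm_divide power_divide)
      show ?thesis unfolding tz[symmetric] one by (simp add: G_def half gh)
    next
      case False
      thus ?thesis unfolding tz[symmetric] iv[symmetric] by (simp add: G_def)
    qed
    have al: "z ^ \<alpha> * cnj z ^ \<beta> = z ^ m * ((1 / z) ^ \<alpha>' * cnj (1 / z) ^ \<beta>') * (z * cnj z) ^ N"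
    proof -
      have e: "z ^ \<alpha> = z ^ m * z ^ N / z ^ \<alpha>'" "cnj z ^ \<beta> = cnj z ^ N / cnj z ^ \<beta>'"
        using power_eq_quotient[of z \<alpha> \<alpha>' "m + N"] power_eq_quotient[of "cnj z" \<beta> \<beta>' N] z0 deg
        by (simp_all add: N_def power_add)
      show ?thesis unfolding e by (simp add: power_one_over power_mult_distrib)
    qed
    have cancel: "K * D / E * (H / (D / E)) = K * H" if "D \<noteq> 0" "E \<noteq> 0" for K D E H :: complex
      using that by simp
    have "u z * G (\<tau> z) = z ^ m * ((1 / z) ^ \<alpha>' * cnj (1 / z) ^ \<beta>') * h ((cmod (1 / z))\<^sup>2)"
      unfolding G u_def al power_divide[of "z * cnj z"]
      by (rule cancel) (use z0 one_plus_norm_nonzero[of z] in simp_all)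
    thus ?thesis using False by (simp add: glue_def)
  qed
  let ?\<xi> = "\<lambda>z. u z * p (\<tau> z)"
  have "?\<xi> \<in> smooth_sections m"
  proof -
    have t1: "\<tau> z = Re (z * cnj z / (1 + z * cnj z))" for z
    proof -
      have "z * cnj z / (1 + z * cnj z) = of_real (\<tau> z)"
        unfolding one_plus_norm by (simp only: \<tau>_def of_real_divide complex_norm_square)
      thus ?thesis by simp
    qed
    have t2: "\<tau> (1 / w) = Re (1 / (1 + w * cnj w))" if "w \<noteq> 0" for w
    proof -
      have "\<tau> (1 / w) = 1 / (1 + (cmod w)\<^sup>2)"
        using that pos[of w] by (simp add: \<tau>_def norm_divide power_divide field_simps)
      hence "1 / (1 + w * cnj w) = of_real (\<tau> (1 / w))"
        unfolding one_plus_norm by (simp only: of_real_divide of_real_1)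
      thus ?thesis by simp
    qed
    let ?t = "\<lambda>w. w ^ \<alpha>' * cnj w ^ \<beta>' / (1 + w * cnj w) ^ N * p (Re (1 / (1 + w * cnj w)))"
    have nz: "(1 + z * cnj z) ^ j \<noteq> 0" for z j using one_plus_norm_nonzero[of z] by simp
    have "smooth ?\<xi>" unfolding t1 u_def
      by (intro smooth_mult smooth_divide smooth_power smooth_add smooth_const smooth_id smooth_cnj
          smooth_polynomial_function[OF p(1)] nz one_plus_norm_nonzero)
    moreover have "smooth ?t"
      by (intro smooth_mult smooth_divide smooth_power smooth_add smooth_const smooth_id smooth_cnj
          smooth_polynomial_function[OF p(1)] nz one_plus_norm_nonzero)
    moreover have "?t w = w ^ m * ?\<xi> (1 / w)" if w: "w \<noteq> 0" for w
    proof -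
      have "1 + 1 / w * cnj (1 / w) = (1 + w * cnj w) / (w * cnj w)"
        using w by (simp add: field_simps)
      hence "u (1 / w) = (1 / w) ^ \<alpha> * (1 / cnj w) ^ \<beta> * (w * cnj w) ^ N / (1 + w * cnj w) ^ N"
        by (simp add: u_def power_divide)
      moreover have "w ^ m * ((1 / w) ^ \<alpha> * (1 / cnj w) ^ \<beta> * (w * cnj w) ^ N) = w ^ \<alpha>' * cnj w ^ \<beta>'"
      proof -
        have e: "w ^ \<alpha>' = w ^ m * w ^ N / w ^ \<alpha>" "cnj w ^ \<beta>' = cnj w ^ N / cnj w ^ \<beta>"
          using power_eq_quotient[of w \<alpha>' \<alpha> "m + N"] power_eq_quotient[of "cnj w" \<beta>' \<beta> N] w deg
          by (simp_all add: N_def power_add add.commute)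
        show ?thesis unfolding e by (simp add: power_one_over power_mult_distrib)
      qed
      ultimately have "w ^ m * u (1 / w) = w ^ \<alpha>' * cnj w ^ \<beta>' / (1 + w * cnj w) ^ N" by simp
      thus ?thesis by (simp only: t2[OF w] mult.assoc[symmetric])
    qed
    ultimately show ?thesis unfolding smooth_sections_def by blast
  qed
  moreover have "cmod (glue m ?A ?B z - ?\<xi> z) \<le> e * max 1 (cmod z) ^ m" for z
  proof -
    have "cmod (glue m ?A ?B z - ?\<xi> z) = cmod (u z) * cmod (G (\<tau> z) - p (\<tau> z))"
      unfolding factor by (simp flip: norm_mult add: algebra_simps)
    also have "\<dots> \<le> max 1 (cmod z) ^ m * e"
      using p(2)[OF \<tau>_01[of z]] by (intro mult_mono u_bound) auto
    finally show ?thesis by (simp add: mult.commute)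
  qed
  ultimately show "\<exists>\<xi>\<in>smooth_sections m. \<forall>z. cmod (glue m ?A ?B z - \<xi> z) \<le> e * max 1 (cmod z) ^ m"
    by (intro bexI[of _ ?\<xi>]) simp_all
qed

lemma bessel_mode_radial:
  "bessel_mode n \<mu> z = z ^ nat n * cnj z ^ nat (- n)
    * ((\<mu> / 2) ^ nat n * (- \<mu> / 2) ^ nat (- n) * bessel_E (nat \<bar>n\<bar>) (\<mu>\<^sup>2 * of_real ((cmod z)\<^sup>2) / 4))"
proof -
  have "- \<mu> * cnj z / 2 = cnj z * (- \<mu> / 2)" "\<mu> * z / 2 = z * (\<mu> / 2)" by simp_all
  hence "bessel_mode n \<mu> z = (if 0 \<le> n then z ^ nat n * (\<mu> / 2) ^ nat n * bessel_E (nat n) (\<mu>\<^sup>2 * (z * cnj z) / 4)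
      else cnj z ^ nat (- n) * (- \<mu> / 2) ^ nat (- n) * bessel_E (nat (- n)) (\<mu>\<^sup>2 * (z * cnj z) / 4))"
    by (simp only: bessel_mode_def power_mult_distrib)
  thus ?thesis unfolding complex_norm_square by (simp add: abs_if)
qed

lemma bessel_E_continuous: "continuous_on UNIV (bessel_E k)"
  by (intro DERIV_continuous_on[OF DERIV_subset[OF bessel_E_deriv]]) auto

lemma bessel_section_in_completion:
  assumes "bessel_matching m n \<mu> a b"
  shows "bessel_section m n \<mu> a b \<in> hilbert_completion m"
proof -
  define c where "c = (\<lambda>n r. (\<mu> / 2) ^ nat n * (- \<mu> / 2) ^ nat (- n) * bessel_E (nat \<bar>n\<bar>) (\<mu>\<^sup>2 * complex_of_real r / 4))"
  have c1: "c n 1 = bessel_J n \<mu>" for n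
    using bessel_mode_radial[of n \<mu> 1] bessel_mode_polar[of n \<mu> 1 0] by (simp add: c_def)
  have cc: "continuous_on UNIV (c n)" for n
    unfolding c_def by (intro continuous_intros continuous_on_compose2[OF bessel_E_continuous]) auto
  have "bessel_section m n \<mu> a b = glue m (\<lambda>z. z ^ nat n * cnj z ^ nat (- n) * (a * c n ((cmod z)\<^sup>2)))
      (\<lambda>w. w ^ nat (int m - n) * cnj w ^ nat (- (int m - n)) * (b * c (int m - n) ((cmod w)\<^sup>2)))"
    unfolding bessel_section_def c_def bessel_mode_radial by (simp only: mult_ac)
  also have "\<dots> \<in> hilbert_completion m"
  proof (rule radial_section_in_completion)
    show "a * c n 1 = b * c (int m - n) 1" using assms by (simp add: c1 bessel_matching_def)
    show "nat n + nat (int m - n) = m + nat (- n) + nat (- (int m - n))" by linarith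
  qed (intro continuous_intros cc)+
  finally show ?thesis .
qed

lemma open_not_AE_avoided:
  assumes "open S" "S \<noteq> {}" "AE z in omega_inf. z \<notin> (S :: complex set)"
  shows False
proof -
  have "AE z in lborel. 0 < ennreal (1 / (pi * max 1 (cmod z) ^ 4)) \<longrightarrow> z \<notin> S"
    using assms(3) unfolding omega_inf_def by (subst (asm) AE_density) auto
  moreover have "0 < ennreal (1 / (pi * max 1 (cmod z) ^ 4))" for z
    by (simp add: ennreal_less_zero_iff zero_less_mult_iff)
  ultimately have "AE z in lborel. z \<notin> S" by simp
  hence "S \<in> null_sets lborel" using assms(1) by (subst AE_iff_null_sets) auto
  hence "negligible S" by (simp add: negligible_iff_null_sets null_sets_completionI)
  thus False using open_not_negligible assms by blast
qed

lemma glue_not_AE_zero: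
  assumes A: "continuous_on UNIV A" and B: "continuous_on UNIV B"
    and ex: "(\<exists>z. cmod z < 1 \<and> A z \<noteq> 0) \<or> (\<exists>w. w \<noteq> 0 \<and> cmod w < 1 \<and> B w \<noteq> 0)"
  shows "\<not> (AE z in omega_inf. glue m A B z = 0)"
proof
  assume ae: "AE z in omega_inf. glue m A B z = 0"
  from ex show False
  proof
    assume "\<exists>z. cmod z < 1 \<and> A z \<noteq> 0"
    then obtain z where z: "cmod z < 1" "A z \<noteq> 0" by blast
    let ?S = "ball 0 1 \<inter> A -` (- {0})"
    have "open ?S"
      by (rule continuous_open_preimage[OF continuous_on_subset[OF A]]) (simp_all add: open_Compl)
    moreover have "z \<in> ?S" using z by simp
    moreover have "AE z in omega_inf. z \<notin> ?S"
      using ae by (rule AE_mp) (auto simp: glue_def intro!: AE_I2)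
    ultimately show False using open_not_AE_avoided by blast
  next
    assume "\<exists>w. w \<noteq> 0 \<and> cmod w < 1 \<and> B w \<noteq> 0"
    then obtain w where w: "w \<noteq> 0" "cmod w < 1" "B w \<noteq> 0" by blast
    let ?S = "(- cball 0 1) \<inter> (\<lambda>z. B (1 / z)) -` (- {0})"
    have "continuous_on (- cball 0 1) (\<lambda>z::complex. 1 / z)" by (intro continuous_intros) auto
    hence "continuous_on (- cball 0 1) (\<lambda>z. B (1 / z))" by (rule continuous_on_compose2[OF B]) simp
    hence "open ?S" by (rule continuous_open_preimage) (simp_all add: open_Compl)
    moreover have "1 / w \<in> ?S" using w by (simp add: norm_divide)
    moreover have "AE z in omega_inf. z \<notin> ?S"
      using ae by (rule AE_mp) (auto simp: glue_def intro!: AE_I2)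
    ultimately show False using open_not_AE_avoided by blast
  qed
qed

lemma bessel_mode_nonzero:
  assumes "\<mu> \<noteq> 0"
  shows "\<exists>z. z \<noteq> 0 \<and> cmod z < 1 \<and> bessel_mode n \<mu> z \<noteq> 0"
proof -
  define k where "k = nat \<bar>n\<bar>"
  have "bessel_E k 0 = bessel_E_coeff k 0"
    unfolding bessel_E_def by (subst suminf_finite[of "{0}"]) auto
  hence "bessel_E k 0 \<noteq> 0" by (simp add: bessel_E_coeff_def)
  have "isCont (bessel_E k) 0"
    using bessel_E_continuous by (simp add: continuous_on_eq_continuous_at)
  have "(\<lambda>j. \<mu>\<^sup>2 * of_real ((cmod (of_real (1 / real (Suc (Suc j)))))\<^sup>2) / 4) \<longlonglongrightarrow> \<mu>\<^sup>2 * of_real ((cmod (of_real 0))\<^sup>2) / 4"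
    by (intro tendsto_intros LIMSEQ_Suc[OF LIMSEQ_Suc[OF lim_1_over_n]]) simp_all
  hence "(\<lambda>j. \<mu>\<^sup>2 * of_real ((cmod (of_real (1 / real (Suc (Suc j)))))\<^sup>2) / 4) \<longlonglongrightarrow> 0" by simp
  with \<open>isCont (bessel_E k) 0\<close> have "(\<lambda>j. bessel_E k (\<mu>\<^sup>2 * of_real ((cmod (of_real (1 / real (Suc (Suc j)))))\<^sup>2) / 4)) \<longlonglongrightarrow> bessel_E k 0"
    by (rule isCont_tendsto_compose)
  hence "\<forall>\<^sub>F j in sequentially. bessel_E k (\<mu>\<^sup>2 * of_real ((cmod (of_real (1 / real (Suc (Suc j)))))\<^sup>2) / 4) \<noteq> 0"
    using \<open>bessel_E k 0 \<noteq> 0\<close> by (rule tendsto_imp_eventually_ne)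
  from eventually_happens'[OF sequentially_bot this] obtain j where j: "bessel_E k (\<mu>\<^sup>2 * of_real ((cmod (of_real (1 / real (Suc (Suc j)))))\<^sup>2) / 4) \<noteq> 0"
    ..
  define z where "z = complex_of_real (1 / real (Suc (Suc j)))"
  have "z \<noteq> 0" "cmod z < 1" by (simp_all add: z_def norm_divide del: of_nat_Suc)
  moreover have "bessel_mode n \<mu> z \<noteq> 0"
    unfolding bessel_mode_radial k_def[symmetric] using assms j[folded z_def] \<open>z \<noteq> 0\<close> by simp
  ultimately show ?thesis by blast
qed

lemma bessel_section_not_AE_zero:
  assumes "\<mu> \<noteq> 0" "a \<noteq> 0 \<or> b \<noteq> 0"
  shows "\<not> (AE z in omega_inf. bessel_section m n \<mu> a b z = 0)"
  unfolding bessel_section_def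
proof (rule glue_not_AE_zero)
  show "(\<exists>z. cmod z < 1 \<and> a * bessel_mode n \<mu> z \<noteq> 0)
      \<or> (\<exists>w. w \<noteq> 0 \<and> cmod w < 1 \<and> b * bessel_mode (int m - n) \<mu> w \<noteq> 0)"
    using bessel_mode_nonzero[OF assms(1), of n] bessel_mode_nonzero[OF assms(1), of "int m - n"] assms(2)
    by auto
qed (intro smooth_continuous_on smooth_mult smooth_const smooth_bessel_mode)+

text \<open>The matching conditions are a homogeneous linear system for \<open>(a, b)\<close> with this determinant.\<close>

lemma bessel_matching_nontrivial:
  assumes "bessel_det m n \<mu> = 0"
  shows "\<exists>a b. (a \<noteq> 0 \<or> b \<noteq> 0) \<and> bessel_matching m n \<mu> a b"
proof -
  define p q r s where "p = bessel_J n \<mu>" and "q = bessel_J (int m - n) \<mu>"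
    and "r = bessel_J (n + 1) \<mu>" and "s = bessel_J (int m - n + 1) \<mu>"
  note defs = p_def q_def r_def s_def
  have det: "p * s + q * r = 0" using assms by (simp add: bessel_det_def defs)
  have M: "bessel_matching m n \<mu> a b \<longleftrightarrow> a * p = b * q \<and> a * r = - b * s" for a b
    by (simp add: bessel_matching_def defs)
  consider "p \<noteq> 0 \<or> q \<noteq> 0" | "p = 0" "q = 0" "r \<noteq> 0 \<or> s \<noteq> 0" | "p = 0" "q = 0" "r = 0" "s = 0" by blast
  thus ?thesis
  proof cases
    case 1
    hence "(q \<noteq> 0 \<or> p \<noteq> 0) \<and> bessel_matching m n \<mu> q p"
      using det by (auto simp: M eq_neg_iff_add_eq_0 add.commute)
    thus ?thesis by blast
  next
    case 2
    hence "(s \<noteq> 0 \<or> - r \<noteq> 0) \<and> bessel_matching m n \<mu> s (- r)" by (auto simp: M)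
    thus ?thesis by blast
  next
    case 3
    hence "((1::complex) \<noteq> 0 \<or> (1::complex) \<noteq> 0) \<and> bessel_matching m n \<mu> 1 1" by (simp add: M)
    thus ?thesis by blast
  qed
qed

section \<open>The eigensections and the spectrum\<close>

lemma bessel_section_inner:
  assumes "cmod z < 1"
  shows "bessel_section m n \<mu> a b z = a * (bessel_J n (\<mu> * of_real (cmod z)) * cis (of_int n * Arg z))"
proof -
  have "z = of_real (cmod z) * cis (Arg z)" using rcis_cmod_Arg[of z] by (simp add: rcis_def)
  hence "bessel_mode n \<mu> z = bessel_J n (\<mu> * of_real (cmod z)) * cis (of_int n * Arg z)"
    using bessel_mode_polar[of n \<mu> "cmod z" "Arg z"] by simp
  thus ?thesis using assms by (simp add: bessel_section_def glue_def)
qed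

lemma bessel_section_outer:
  assumes "\<not> cmod z < 1"
  shows "bessel_section m n \<mu> a b z = b * (- 1) ^ nat \<bar>int m - n\<bar> * of_real (cmod z) ^ m
    * bessel_J (n - int m) (\<mu> / of_real (cmod z)) * cis (of_int n * Arg z)"
proof -
  define r t where "r = cmod z" and "t = Arg z"
  have z: "z = of_real r * cis t" using rcis_cmod_Arg[of z] by (simp add: rcis_def r_def t_def)
  have r: "r \<noteq> 0" using assms by (auto simp: r_def)
  have iz: "1 / z = of_real (1 / r) * cis (- t)"
    unfolding z by (simp add: divide_inverse cis_inverse)
  have J: "bessel_J (int m - n) x = (- 1) ^ nat \<bar>int m - n\<bar> * bessel_J (n - int m) x" for x
    using bessel_J_minus[of "n - int m" x] by (simp add: abs_minus_commute)
  have zm: "z ^ m = of_real r ^ m * cis (real m * t)"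
    unfolding z power_mult_distrib Complex.DeMoivre by simp
  have c: "cis (real m * t) * cis (of_int (int m - n) * (- t)) = cis (of_int n * t)"
    unfolding cis_mult by (rule arg_cong[of _ _ cis]) (simp add: algebra_simps)
  have "bessel_section m n \<mu> a b z = z ^ m * (b * bessel_mode (int m - n) \<mu> (1 / z))"
    using assms by (simp add: bessel_section_def glue_def)
  also have "\<dots> = of_real r ^ m * b * bessel_J (int m - n) (\<mu> * of_real (1 / r))
      * (cis (real m * t) * cis (of_int (int m - n) * (- t)))"
    unfolding iz bessel_mode_polar zm by (simp only: mult_ac)
  also have "\<dots> = b * (- 1) ^ nat \<bar>int m - n\<bar> * of_real r ^ m * bessel_J (n - int m) (\<mu> / of_real r) * cis (of_int n * t)"
    unfolding c J by simp
  finally show ?thesis by (simp only: r_def t_def)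
qed

text \<open>
  The given eigensections: for \<open>m \<ge> 1\<close> continuity fixes the ratio of the two branches; for
  \<open>m = 0\<close> the vanishing determinant is \<open>2 J_n J_n' = 0\<close> up to sign, and the two factors
  correspond to the even and the odd continuation across the equator.
\<close>

lemma phi_eigen_bessel_section:
  assumes \<mu>: "\<mu> \<noteq> 0" and det: "bessel_det m n \<mu> = 0"
    and nz: "m \<ge> 1 \<Longrightarrow> bessel_J n \<mu> \<noteq> 0 \<and> bessel_J (n - int m) \<mu> \<noteq> 0"
  shows "\<exists>a b. bessel_matching m n \<mu> a b \<and> phi_eigen m n \<mu> = bessel_section m n \<mu> a b"
proof -
  define s where "s = (- 1 :: complex) ^ nat \<bar>int m - n\<bar>"
  have ss: "s * s = 1" by (simp add: s_def flip: power_mult_distrib)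
  have J: "bessel_J (n - int m) x = s * bessel_J (int m - n) x" for x
    using bessel_J_minus[of "int m - n" x] by (simp add: s_def)
  show ?thesis
  proof (cases "m \<ge> 1")
    case True
    define b where "b = bessel_J n \<mu> / bessel_J (int m - n) \<mu>"
    have q: "bessel_J (int m - n) \<mu> \<noteq> 0" using nz[OF True] by (auto simp: J)
    have "bessel_matching m n \<mu> 1 b"
      using det q by (simp add: bessel_matching_def b_def bessel_det_def eq_neg_iff_add_eq_0 field_simps)
    moreover have bs: "b * s = bessel_J n \<mu> / bessel_J (n - int m) \<mu>"
    proof -
      have "s \<noteq> 0" using ss by auto
      hence "s = 1 / s" using ss by (simp add: field_simps)
      hence "b * s = b * (1 / s)" by (rule arg_cong)
      thus ?thesis by (simp add: b_def J mult.commute)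
    qed
    moreover have "phi_eigen m n \<mu> z = bessel_section m n \<mu> 1 b z" for z
    proof (cases "cmod z < 1")
      case True
      thus ?thesis using \<open>m \<ge> 1\<close> by (simp add: phi_eigen_def tensor_z_def f_eigen_def Let_def bessel_section_inner)
    next
      case False
      thus ?thesis using \<open>m \<ge> 1\<close>
        by (simp add: phi_eigen_def tensor_z_def f_eigen_def Let_def bessel_section_outer s_def[symmetric] bs)
    qed
    ultimately show ?thesis by blast
  next
    case False
    hence m: "m = 0" by simp
    have s0: "s = (- 1) ^ nat \<bar>n\<bar>" by (simp add: s_def m)
    have J1: "bessel_J (- n) \<mu> = s * bessel_J n \<mu>" "bessel_J (1 - n) \<mu> = - s * bessel_J (n - 1) \<mu>"
      using bessel_J_minus[of n \<mu>] bessel_J_minus_shift(2)[of n \<mu>] by (simp_all add: s0)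
    have dJ: "deriv (bessel_J n) \<mu> = (bessel_J (n - 1) \<mu> - bessel_J (n + 1) \<mu>) / 2"
      by (rule DERIV_imp_deriv[OF bessel_J_deriv])
    define a where "a = (if deriv (bessel_J n) \<mu> = 0 then 1 else - 1 :: complex)"
    have ssx: "s * (s * x) = x" for x using ss by (simp flip: mult.assoc)
    have "bessel_matching m n \<mu> a s"
    proof (cases "deriv (bessel_J n) \<mu> = 0")
      case True
      thus ?thesis by (simp add: bessel_matching_def a_def m J1 ssx dJ)
    next
      case False
      have "s * (bessel_J n \<mu> * (bessel_J (n + 1) \<mu> - bessel_J (n - 1) \<mu>)) = 0"
        using det by (simp add: bessel_det_def m J1 algebra_simps)
      moreover have "s \<noteq> 0" using ss by auto
      ultimately have J0: "bessel_J n \<mu> = 0" using False by (simp add: dJ)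
      hence "bessel_J (n - 1) \<mu> + bessel_J (n + 1) \<mu> = 0"
        using bessel_J_recurrence[of \<mu> n] \<mu> by simp
      hence "- bessel_J (n + 1) \<mu> = bessel_J (n - 1) \<mu>" by (simp add: add_eq_0_iff)
      thus ?thesis using False by (simp add: bessel_matching_def a_def m J1 ssx J0)
    qed
    moreover have "phi_eigen m n \<mu> z = bessel_section m n \<mu> a s z" for z
    proof (cases "cmod z < 1")
      case True
      thus ?thesis
        by (simp add: m phi_eigen_def tensor_z_def f_eigen_def Let_def bessel_section_inner a_def)
    next
      case False
      thus ?thesis
        by (simp add: m phi_eigen_def tensor_z_def f_eigen_def Let_def bessel_section_outer s0[symmetric] ss)
    qed
    ultimately show ?thesis by blast
  qed
qed

lemma phi_eigen_eigensection:
  assumes "\<mu> \<noteq> 0" "bessel_det m n \<mu> = 0"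
    "m \<ge> 1 \<Longrightarrow> bessel_J n \<mu> \<noteq> 0 \<and> bessel_J (n - int m) \<mu> \<noteq> 0" "\<xi> \<in> smooth_sections m"
  shows "L2_inner m (phi_eigen m n \<mu>) (laplacian m \<xi>) = \<mu>\<^sup>2 / 4 * L2_inner m (phi_eigen m n \<mu>) \<xi>"
proof -
  obtain a b where "bessel_matching m n \<mu> a b" "phi_eigen m n \<mu> = bessel_section m n \<mu> a b"
    using phi_eigen_bessel_section[OF assms(1,2,3)] by blast
  thus ?thesis using bessel_section_eigen[OF _ assms(4)] by simp
qed

lemma power_harmonic:
  assumes "k \<le> m" "\<xi> \<in> smooth_sections m"
  shows "L2_inner m (\<lambda>z. z ^ k) (laplacian m \<xi>) = 0"
  using weak_eigensection[OF matched_power(1)[OF assms(1)], of 0 \<xi>] assms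
    matched_power(2)[OF assms(1)] matched_power(2)[of "m - k" m]
  by (simp add: matched_power(3))

lemma zero_in_spec: "0 \<in> laplacian_spec m"
proof -
  have "smooth (\<lambda>w. w ^ m)" by (intro smooth_power smooth_id)
  hence "(\<lambda>z. 1) \<in> smooth_sections m"
    by (auto simp: smooth_sections_def intro!: smooth_const exI[of _ "\<lambda>w. w ^ m"])
  hence "(\<lambda>z. 1) \<in> hilbert_completion m" by (rule smooth_section_in_completion)
  moreover have "\<not> (AE z in omega_inf. (1::complex) = 0)"
  proof
    assume "AE z in omega_inf. (1::complex) = 0"
    hence "AE z in omega_inf. z \<notin> (UNIV :: complex set)" by simp
    thus False using open_not_AE_avoided[of UNIV] by simp
  qed
  ultimately show ?thesis
    unfolding laplacian_spec_def using power_harmonic[of 0 m] by fastforce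
qed

text \<open>
  A zero of the determinant always yields a nonzero pair of coefficients, including the case in
  which \<open>J_n\<close> and \<open>J_(n-m)\<close> vanish simultaneously.
\<close>

lemma bessel_Z_in_spec:
  assumes "\<mu> \<in> bessel_Z m n"
  shows "\<mu>\<^sup>2 / 4 \<in> laplacian_spec m"
proof -
  have \<mu>: "\<mu> \<noteq> 0" "bessel_det m n \<mu> = 0" using assms by (simp_all add: bessel_Z_det)
  obtain a b where ab: "a \<noteq> 0 \<or> b \<noteq> 0" "bessel_matching m n \<mu> a b"
    using bessel_matching_nontrivial[OF \<mu>(2)] by blast
  show ?thesis
    unfolding laplacian_spec_def
    using bessel_section_in_completion[OF ab(2)] bessel_section_not_AE_zero[OF \<mu>(1) ab(1), of m n]
      bessel_section_eigen[OF ab(2)] by blast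
qed

theorem mainTheorem4:
  fixes m :: nat
  shows "(\<forall>k\<le>m. \<forall>\<xi>\<in>smooth_sections m. L2_inner m ((\<lambda>_. 1) \<otimes>z k) (laplacian m \<xi>) = 0)
    \<and> (\<forall>n::int. \<forall>\<mu>\<in>bessel_Z m n. (m \<ge> 1 \<longrightarrow> bessel_J n \<mu> * bessel_J (n - int m) \<mu> \<noteq> 0) \<longrightarrow>
        (\<forall>\<xi>\<in>smooth_sections m.
          L2_inner m (phi_eigen m n \<mu>) (laplacian m \<xi>)
            = \<mu>\<^sup>2 / 4 * L2_inner m (phi_eigen m n \<mu>) \<xi> \<and>
          L2_inner m (phi_eigen m (- n + int m) \<mu>) (laplacian m \<xi>)
            = \<mu>\<^sup>2 / 4 * L2_inner m (phi_eigen m (- n + int m) \<mu>) \<xi>))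
    \<and> {0} \<union> {\<mu>\<^sup>2 / 4 | \<mu>. \<exists>n::nat. \<mu> \<in> bessel_Z m (int n)} \<subseteq> laplacian_spec m"
proof (intro conjI allI ballI impI)
  fix k \<xi> assume "k \<le> m" "\<xi> \<in> smooth_sections m"
  thus "L2_inner m ((\<lambda>_. 1) \<otimes>z k) (laplacian m \<xi>) = 0"
    using power_harmonic by (simp add: tensor_z_def)
next
  fix n :: int and \<mu> \<xi>
  assume "\<mu> \<in> bessel_Z m n" and nz: "m \<ge> 1 \<longrightarrow> bessel_J n \<mu> * bessel_J (n - int m) \<mu> \<noteq> 0"
    and \<xi>: "\<xi> \<in> smooth_sections m"
  hence \<mu>: "\<mu> \<noteq> 0" "bessel_det m n \<mu> = 0" by (simp_all add: bessel_Z_det)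
  show "L2_inner m (phi_eigen m n \<mu>) (laplacian m \<xi>) = \<mu>\<^sup>2 / 4 * L2_inner m (phi_eigen m n \<mu>) \<xi>"
    using nz by (intro phi_eigen_eigensection \<mu> \<xi>) auto
  have "bessel_det m (- n + int m) \<mu> = 0"
    using \<mu>(2) bessel_det_sym[of m n \<mu>] by (simp add: algebra_simps)
  moreover have "bessel_J (- n + int m) \<mu> \<noteq> 0 \<and> bessel_J (- n + int m - int m) \<mu> \<noteq> 0" if "m \<ge> 1"
    using nz that bessel_J_minus[of n \<mu>] bessel_J_minus[of "n - int m" \<mu>] by (simp add: algebra_simps)
  ultimately show "L2_inner m (phi_eigen m (- n + int m) \<mu>) (laplacian m \<xi>)
      = \<mu>\<^sup>2 / 4 * L2_inner m (phi_eigen m (- n + int m) \<mu>) \<xi>"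
    by (intro phi_eigen_eigensection \<mu>(1) \<xi>)
next
  show "{0} \<union> {\<mu>\<^sup>2 / 4 | \<mu>. \<exists>n::nat. \<mu> \<in> bessel_Z m (int n)} \<subseteq> laplacian_spec m"
    using zero_in_spec bessel_Z_in_spec by blast
qed

end
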